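(* Let $K$ be an ellipsoid in a Hilbert space $\mathcal{H}$ such that the sequence $\{d_n(K)\}_{n=1}^\infty$ of Kolmogorov widths is not lacunary. Then the closure of $G(K)$ in the ultra-weak topology coincides with $\mathcal{L}(\mathcal{H})$.
   Context: An ellipsoid in a Hilbert space $\mathcal{H}$ is a set of the form $A(B_{\mathcal{H}'})$, where $\mathcal{H}'$ is a Hilbert space, $B_{\mathcal{H}'}$ its closed unit ball, and $A:\mathcal{H}'\to\mathcal{H}$ a compact linear operator with infinite-dimensional range. $\mathcal{L}(\mathcal{H})$ is the space of bounded linear operators on $\mathcal{H}$; $G(K)=\{D\in\mathcal{L}(\mathcal{H}): DK\supset K\}$. The ultra-weak topology on $\mathcal{L}(\mathcal{H})$ is the weak$^*$ topology corresponding to the trace duality $\mathcal{L}(\mathcal{H})=(C_1(\mathcal{H}))^*$, where $C_1(\mathcal{H})$ is the space of nuclear (trace class) operators. The Kolmogorov $n$-width is $d_n(K)=\inf_{\mathcal{X}_n}\sup_{x\in K}\inf_{z\in \mathcal{X}_n}\|x-z\|$, the outer infimum being over all $n$-dimensional linear subspaces $\mathcal{X}_n$ of $\mathcal{H}$. A non-increasing sequence $\{a_n\}$ of positive numbers with $\lim a_n=0$ is called lacunary if $\liminf_{n\to\infty}a_{n+1}/a_n=0$. *)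

theory Defs
  imports "HOL-Analysis.Analysis"
begin

text \<open>
  Scalars of a Hilbert space. Up to isomorphism the only instances are \<open>real\<close> with the identity
  and \<open>complex\<close> with \<open>cnj\<close>: by \<open>scnj_fixed_real\<close> below, \<open>(x + scnj x) / 2\<close> is always real, so
  every element is quadratic over the reals.
\<close>

class hilbert_scalar = real_normed_field + banach +
  fixes scnj :: "'a \<Rightarrow> 'a"
  assumes scnj_add: "scnj (x + y) = scnj x + scnj y"
    and scnj_mult: "scnj (x * y) = scnj x * scnj y"
    and scnj_scnj: "scnj (scnj x) = x"
    and mult_scnj: "x * scnj x = (norm x)\<^sup>2 *\<^sub>R 1"

instantiation real :: hilbert_scalar
begin
definition scnj_real :: "real \<Rightarrow> real" where "scnj_real x = x"
instance by standard (simp_all add: scnj_real_def power2_eq_square)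
end

instantiation complex :: hilbert_scalar
begin
definition scnj_complex :: "complex \<Rightarrow> complex" where "scnj_complex = cnj"
instance
proof
  fix z :: complex
  show "z * scnj z = (norm z)\<^sup>2 *\<^sub>R 1"
    unfolding scnj_complex_def scaleR_conv_of_real complex_norm_square by (rule mult_1_right[symmetric])
qed (simp_all add: scnj_complex_def)
end

lemma scnj_fixed_real:
  fixes x :: "'k::hilbert_scalar"
  assumes "scnj x = x"
  shows "x \<in> \<real>"
proof -
  have "(x - of_real (norm x)) * (x + of_real (norm x)) = 0"
    using mult_scnj[of x] assms by (simp add: scaleR_conv_of_real algebra_simps power2_eq_square)
  then have "x = of_real (norm x) \<or> x = of_real (- norm x)"
    by (auto simp: add_eq_0_iff2)
  then show ?thesis
    using Reals_of_real by metis
qed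

text \<open>
  A Hilbert space over the scalars \<open>'k\<close>: the norm of the (complete) type \<open>'a\<close> is the one induced
  by the \<open>'k\<close>-valued inner product \<open>ip\<close>, which is linear in its first argument.
\<close>

locale hilbert_space = vector_space sc
  for sc :: "'k::hilbert_scalar \<Rightarrow> 'a::banach \<Rightarrow> 'a" +
  fixes ip :: "'a \<Rightarrow> 'a \<Rightarrow> 'k"
  assumes scale_of_real: "sc (of_real r) x = r *\<^sub>R x"
    and ip_add_left: "ip (x + y) z = ip x z + ip y z"
    and ip_scale_left: "ip (sc c x) y = c * ip x y"
    and ip_commute: "ip y x = scnj (ip x y)"
    and ip_self: "ip x x = of_real ((norm x)\<^sup>2)"

lemma hilbert_space_real:
  "hilbert_space (scaleR :: real \<Rightarrow> 'a::{real_inner,banach} \<Rightarrow> 'a) inner"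
proof unfold_locales
  show "x \<bullet> x = of_real ((norm x)\<^sup>2)" for x :: 'a
    by (simp add: power2_norm_eq_inner)
  show "y \<bullet> x = scnj (x \<bullet> y)" for x y :: 'a
    unfolding scnj_real_def by (rule inner_commute)
qed (simp_all add: scaleR_add_right scaleR_add_left inner_add_left)

lemma hilbert_space_complex:
  "hilbert_space ((*) :: complex \<Rightarrow> complex \<Rightarrow> complex) (\<lambda>x y. x * cnj y)"
proof unfold_locales
  show "x * cnj x = of_real ((norm x)\<^sup>2)" for x
    by (rule complex_norm_square[symmetric])
qed (simp_all add: distrib_left distrib_right scnj_complex_def scaleR_conv_of_real)

definition bounded_operators ::
    "('k::hilbert_scalar \<Rightarrow> 'a::banach \<Rightarrow> 'a) \<Rightarrow> ('a \<Rightarrow> 'a) set" where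
  "bounded_operators sc =
     {D. Vector_Spaces.linear sc sc D \<and> (\<exists>C. \<forall>x. norm (D x) \<le> C * norm x)}"

definition compact_operator ::
    "('k::hilbert_scalar \<Rightarrow> 'b::banach \<Rightarrow> 'b) \<Rightarrow> ('k \<Rightarrow> 'a::banach \<Rightarrow> 'a) \<Rightarrow> ('b \<Rightarrow> 'a) \<Rightarrow> bool" where
  "compact_operator sc' sc A \<longleftrightarrow>
     Vector_Spaces.linear sc' sc A \<and> compact (closure (A ` cball 0 1))"

definition finite_dimensional ::
    "('k::hilbert_scalar \<Rightarrow> 'a::banach \<Rightarrow> 'a) \<Rightarrow> 'a set \<Rightarrow> bool" where
  "finite_dimensional sc V \<longleftrightarrow> (\<exists>S. finite S \<and> V \<subseteq> module.span sc S)"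

text \<open>
  The auxiliary Hilbert space is the type \<open>'b\<close> with scalar multiplication \<open>sc'\<close>. A definition
  cannot quantify existentially over types, so it is a parameter; in a hypothesis this amounts to
  the existential reading.
\<close>

definition ellipsoid ::
    "('k::hilbert_scalar \<Rightarrow> 'b::banach \<Rightarrow> 'b) \<Rightarrow> ('k \<Rightarrow> 'a::banach \<Rightarrow> 'a) \<Rightarrow> 'a set \<Rightarrow> bool" where
  "ellipsoid sc' sc K \<longleftrightarrow>
     (\<exists>A. compact_operator sc' sc A \<and> \<not> finite_dimensional sc (range A) \<and>
          K = A ` cball 0 1)"

definition G_set ::
    "('k::hilbert_scalar \<Rightarrow> 'a::banach \<Rightarrow> 'a) \<Rightarrow> 'a set \<Rightarrow> ('a \<Rightarrow> 'a) set" where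
  "G_set sc K = {D \<in> bounded_operators sc. K \<subseteq> D ` K}"

text \<open>
  The \<open>n\<close>-dimensional subspaces are given by bases because the library's \<open>dim\<close> is \<open>0\<close> on
  infinite-dimensional spaces.
\<close>

definition subspaces_of_dim ::
    "('k::hilbert_scalar \<Rightarrow> 'a::banach \<Rightarrow> 'a) \<Rightarrow> nat \<Rightarrow> 'a set set" where
  "subspaces_of_dim sc n =
     {module.span sc B | B. finite B \<and> card B = n \<and> \<not> module.dependent sc B}"

text \<open>
  The real-valued infima and supremum are the intended ones when \<open>K\<close> is nonempty and bounded and
  the ambient space has dimension at least \<open>n\<close>, as is the case for ellipsoids.
\<close>

definition kolmogorov_width ::
    "('k::hilbert_scalar \<Rightarrow> 'a::banach \<Rightarrow> 'a) \<Rightarrow> 'a set \<Rightarrow> nat \<Rightarrow> real" where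
  "kolmogorov_width sc K n =
     (INF X\<in>subspaces_of_dim sc n. SUP x\<in>K. INF z\<in>X. norm (x - z))"

text \<open>Intended for non-increasing sequences of positive numbers that tend to \<open>0\<close>.\<close>

definition lacunary :: "(nat \<Rightarrow> real) \<Rightarrow> bool" where
  "lacunary a \<longleftrightarrow> liminf (\<lambda>n. ereal (a (Suc n) / a n)) = 0"

definition nuclear ::
    "('k::hilbert_scalar \<Rightarrow> 'a::banach \<Rightarrow> 'a) \<Rightarrow> ('a \<Rightarrow> 'a \<Rightarrow> 'k) \<Rightarrow> ('a \<Rightarrow> 'a) \<Rightarrow> bool" where
  "nuclear sc ip T \<longleftrightarrow>
     (\<exists>x y :: nat \<Rightarrow> 'a. summable (\<lambda>n. norm (x n) * norm (y n)) \<and>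
        (\<forall>h. (\<lambda>n. sc (ip h (y n)) (x n)) sums T h))"

definition orthonormal_basis ::
    "('k::hilbert_scalar \<Rightarrow> 'a::banach \<Rightarrow> 'a) \<Rightarrow> ('a \<Rightarrow> 'a \<Rightarrow> 'k) \<Rightarrow> 'a set \<Rightarrow> bool" where
  "orthonormal_basis sc ip E \<longleftrightarrow>
     (\<forall>e\<in>E. \<forall>f\<in>E. ip e f = (if e = f then 1 else 0)) \<and>
     closure (module.span sc E) = UNIV"

text \<open>For a nuclear operator the sum converges absolutely and does not depend on the basis.\<close>

definition operator_trace ::
    "('k::hilbert_scalar \<Rightarrow> 'a::banach \<Rightarrow> 'a) \<Rightarrow> ('a \<Rightarrow> 'a \<Rightarrow> 'k) \<Rightarrow> ('a \<Rightarrow> 'a) \<Rightarrow> 'k" where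
  "operator_trace sc ip T = (\<Sum>\<^sub>\<infinity>e\<in>(SOME E. orthonormal_basis sc ip E). ip (T e) e)"

text \<open>
  The coarsest topology on the bounded operators for which \<open>D \<mapsto> trace (D T)\<close> is continuous for
  every nuclear \<open>T\<close>.
\<close>

definition ultraweak_topology ::
    "('k::hilbert_scalar \<Rightarrow> 'a::banach \<Rightarrow> 'a) \<Rightarrow> ('a \<Rightarrow> 'a \<Rightarrow> 'k) \<Rightarrow> ('a \<Rightarrow> 'a) topology" where
  "ultraweak_topology sc ip =
     topology_generated_by
       {{D \<in> bounded_operators sc. operator_trace sc ip (D \<circ> T) \<in> U} | T U.
          nuclear sc ip T \<and> open U}"

end

theory Submission
  imports Defs
begin

text \<open>
  A singular value decomposition writes \<open>K\<close> as an ellipsoid with orthonormal axes \<open>e\<^sub>n\<close> and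
  half-lengths \<open>s\<^sub>n\<close>, where \<open>s\<^sub>n = d\<^sub>n(K)\<close> (\<open>n = 0, 1, \<dots>\<close>), so non-lacunarity says that
  \<open>s\<^sub>n\<^sub>+\<^sub>1 \<ge> c s\<^sub>n\<close> for some \<open>c > 0\<close>. Hence the operator that sends \<open>e\<^sub>n\<^sub>+\<^sub>M\<close> to \<open>c\<^sup>-\<^sup>M e\<^sub>n\<close> maps
  the part of \<open>K\<close> spanned by the axes from \<open>M\<close> on onto a superset of \<open>K\<close>, and it stays in \<open>G(K)\<close>
  when any bounded operator vanishing on those axes is added. Given nuclear \<open>T\<^sub>1, \<dots>, T\<^sub>m\<close>, for large
  \<open>M\<close> the vectors \<open>(tr(F T\<^sub>i))\<^sub>i\<close> with \<open>F\<close> vanishing on the axes from \<open>M\<close> on already exhaust the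
  vectors \<open>(tr(D T\<^sub>i))\<^sub>i\<close> with \<open>D\<close> bounded. So the added operator can be chosen to reproduce exactly
  the values \<open>tr(D T\<^sub>i)\<close> of any prescribed \<open>D\<close>, however large \<open>c\<^sup>-\<^sup>M\<close> is.
\<close>

section \<open>Hilbert spaces over an abstract scalar field\<close>

lemma scnj_0 [simp]: "scnj (0 :: 'k::hilbert_scalar) = 0"
  using scnj_add[of "0::'k" 0] by simp

text \<open>The class axioms make conjugation additive and multiplicative; that it fixes the reals
  comes from \<open>mult_scnj\<close>, which makes the product with the conjugate equal to
  \<open>r * r\<close>, after which a nonzero \<open>r\<close> cancels.\<close>

lemma scnj_of_real [simp]: "scnj (of_real r :: 'k::hilbert_scalar) = of_real r"
proof (cases "r = 0")
  case False
  have "of_real r * scnj (of_real r :: 'k) = of_real r * of_real r"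
    by (simp add: mult_scnj scaleR_conv_of_real power2_eq_square flip: of_real_mult)
  with False show ?thesis
    by simp
qed simp

lemma norm_scnj [simp]: "norm (scnj x) = norm (x :: 'k::hilbert_scalar)"
proof (cases "x = 0")
  case False
  have "norm (x * scnj x) = (norm x)\<^sup>2"
    unfolding mult_scnj by simp
  with False show ?thesis
    by (simp add: norm_mult power2_eq_square)
qed simp

lemma scnj_mult_self: "scnj x * x = of_real ((norm (x :: 'k::hilbert_scalar))\<^sup>2)"
  using mult_scnj[of x] by (simp add: mult.commute scaleR_conv_of_real)

context hilbert_space
begin

lemma scaleR_sc: "r *\<^sub>R x = sc (of_real r) x"
  by (simp add: scale_of_real)

lemma ip_add_right: "ip x (y + z) = ip x y + ip x z"
  using ip_commute[of x] by (metis ip_add_left scnj_add)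

lemma ip_scale_right: "ip x (sc c y) = scnj c * ip x y"
  using ip_commute[of x] by (metis ip_scale_left scnj_mult)

lemma ip_zero_left [simp]: "ip 0 x = 0"
  using ip_add_left[of 0 0 x] by simp

lemma ip_zero_right [simp]: "ip x 0 = 0"
  using ip_add_right[of x 0 0] by simp

lemma ip_eq_0_commute: "ip x y = 0 \<longleftrightarrow> ip y x = 0"
  by (metis ip_commute scnj_0)

lemma norm_sc: "norm (sc c x) = norm c * norm x"
proof -
  have "(of_real ((norm (sc c x))\<^sup>2) :: 'k) = c * scnj c * of_real ((norm x)\<^sup>2)"
    by (simp only: ip_self[symmetric] ip_scale_left ip_scale_right mult.assoc mult.left_commute)
  also have "\<dots> = of_real ((norm c * norm x)\<^sup>2)"
    by (simp add: mult_scnj scaleR_conv_of_real power_mult_distrib)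
  finally have "(norm (sc c x))\<^sup>2 = (norm c * norm x)\<^sup>2"
    by (simp only: of_real_eq_iff)
  then show ?thesis
    by (simp add: power2_eq_iff_nonneg)
qed

lemma ip_scaleR_left: "ip (r *\<^sub>R x) y = r *\<^sub>R ip x y"
  by (simp add: scaleR_sc ip_scale_left scaleR_conv_of_real)

lemma ip_scaleR_right: "ip x (r *\<^sub>R y) = r *\<^sub>R ip x y"
  by (simp add: scaleR_sc ip_scale_right scaleR_conv_of_real)

lemma ip_minus_left: "ip (- x) y = - ip x y"
  using ip_scaleR_left[of "-1"] by simp

lemma ip_minus_right: "ip x (- y) = - ip x y"
  using ip_scaleR_right[of _ "-1"] by simp

lemma ip_diff_left: "ip (x - y) z = ip x z - ip y z"
  using ip_add_left[of x "- y" z] by (simp add: ip_minus_left)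

lemma ip_diff_right: "ip x (y - z) = ip x y - ip x z"
  using ip_add_right[of x y "- z"] by (simp add: ip_minus_right)

text \<open>The identity serves twice: nonnegativity of its left side is Cauchy-Schwarz, and in
  \<open>exists_orthogonal_unit\<close> it shows that a nearest point leaves an orthogonal
  residual.\<close>

lemma norm_diff_projection:
  assumes "y \<noteq> 0"
  shows "(norm (x - sc (ip x y / of_real ((norm y)\<^sup>2)) y))\<^sup>2 =
         (norm x)\<^sup>2 - (norm (ip x y))\<^sup>2 / (norm y)\<^sup>2"
proof -
  define c where "c = ip x y / of_real ((norm y)\<^sup>2)"
  have c: "c * of_real ((norm y)\<^sup>2) = ip x y"
    using assms by (simp add: c_def)
  have cc: "scnj c * ip x y = of_real ((norm (ip x y))\<^sup>2 / (norm y)\<^sup>2)"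
  proof -
    have "scnj c * ip x y = scnj c * c * of_real ((norm y)\<^sup>2)"
      by (simp only: c[symmetric] mult.assoc)
    also have "\<dots> = of_real ((norm c)\<^sup>2 * (norm y)\<^sup>2)"
      by (simp only: scnj_mult_self of_real_mult)
    also have "(norm c)\<^sup>2 * (norm y)\<^sup>2 = (norm (ip x y))\<^sup>2 / (norm y)\<^sup>2"
      using assms by (simp add: c_def norm_divide norm_power power_divide) (simp add: power2_eq_square power4_eq_xxxx)
    finally show ?thesis .
  qed
  have "ip (x - sc c y) (x - sc c y) =
        ip x x - scnj c * ip x y - (c * ip y x - scnj c * (c * of_real ((norm y)\<^sup>2)))"
    by (simp add: ip_diff_left ip_diff_right ip_scale_left ip_scale_right ip_self[of y] algebra_simps)
  \<comment> \<open>\<open>c * ip y x\<close> is the conjugate of \<open>scnj c * ip x y\<close>,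
    which is real by \<open>cc\<close>, so the terms in the last parenthesis cancel.\<close>
  also have "\<dots> = ip x x - scnj c * ip x y - (scnj (scnj c * ip x y) - scnj c * ip x y)"
    by (simp only: c scnj_mult scnj_scnj ip_commute[of y x])
  also have "\<dots> = of_real ((norm x)\<^sup>2 - (norm (ip x y))\<^sup>2 / (norm y)\<^sup>2)"
    by (simp only: cc scnj_of_real ip_self diff_self diff_0_right of_real_diff)
  finally show ?thesis
    unfolding c_def[symmetric] ip_self by (simp only: of_real_eq_iff)
qed

lemma Cauchy_Schwarz: "norm (ip x y) \<le> norm x * norm y"
proof (cases "y = 0")
  case False
  have "0 \<le> (norm x)\<^sup>2 - (norm (ip x y))\<^sup>2 / (norm y)\<^sup>2"
    by (subst norm_diff_projection[OF False, symmetric]) simp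
  then have "(norm (ip x y))\<^sup>2 \<le> (norm x * norm y)\<^sup>2"
    using False by (simp add: field_simps power_mult_distrib)
  then show ?thesis
    by (rule power2_le_imp_le) simp
qed simp

lemma bounded_bilinear_ip: "bounded_bilinear ip"
  by (standard; (intro ip_add_left ip_add_right ip_scaleR_left ip_scaleR_right)?)
     (metis Cauchy_Schwarz mult.right_neutral)

sublocale ip: bounded_bilinear ip
  by (rule bounded_bilinear_ip)

lemma bounded_bilinear_sc: "bounded_bilinear sc"
proof
  show "sc (r *\<^sub>R a) b = r *\<^sub>R sc a b" for r a b
    by (simp add: scaleR_sc scaleR_conv_of_real)
  show "sc a (r *\<^sub>R b) = r *\<^sub>R sc a b" for r a b
    by (simp add: scaleR_sc scale_left_commute)
  show "\<exists>K. \<forall>a b. norm (sc a b) \<le> norm a * norm b * K"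
    by (rule exI[of _ 1]) (simp add: norm_sc)
qed (simp_all add: scale_left_distrib scale_right_distrib)

sublocale sc: bounded_bilinear sc
  by (rule bounded_bilinear_sc)

lemma pythagoras:
  fixes x y :: 'a
  assumes "ip x y = 0"
  shows "(norm (x + y))\<^sup>2 = (norm x)\<^sup>2 + (norm y)\<^sup>2"
proof -
  have "ip (x + y) (x + y) = ip x x + ip y y"
    using assms ip_eq_0_commute[of x y] by (simp add: ip_add_left ip_add_right)
  then show ?thesis
    by (simp only: ip_self of_real_eq_iff flip: of_real_add)
qed

lemma parallelogram:
  fixes x y :: 'a
  shows "(norm (x + y))\<^sup>2 + (norm (x - y))\<^sup>2 = 2 * (norm x)\<^sup>2 + 2 * (norm y)\<^sup>2"
proof -
  have "ip (x + y) (x + y) + ip (x - y) (x - y) = 2 * ip x x + 2 * ip y y"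
    by (simp add: ip_add_left ip_add_right ip_diff_left ip_diff_right)
  then have "(of_real ((norm (x + y))\<^sup>2 + (norm (x - y))\<^sup>2) :: 'k) = of_real (2 * (norm x)\<^sup>2 + 2 * (norm y)\<^sup>2)"
    by (simp only: ip_self of_real_add of_real_mult of_real_numeral)
  then show ?thesis
    by (simp only: of_real_eq_iff)
qed

section \<open>Finite orthonormal systems\<close>

definition orthonormal :: "('i \<Rightarrow> 'a) \<Rightarrow> 'i set \<Rightarrow> bool" where
  "orthonormal e I \<longleftrightarrow> (\<forall>i\<in>I. \<forall>j\<in>I. ip (e i) (e j) = (if i = j then 1 else 0))"

lemma orthonormalD: "orthonormal e I \<Longrightarrow> i \<in> I \<Longrightarrow> j \<in> I \<Longrightarrow> ip (e i) (e j) = (if i = j then 1 else 0)"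
  by (simp add: orthonormal_def)

lemma orthonormal_mono: "orthonormal e I \<Longrightarrow> J \<subseteq> I \<Longrightarrow> orthonormal e J"
  unfolding orthonormal_def by blast

lemma orthonormal_norm:
  assumes "orthonormal e I" "i \<in> I"
  shows "norm (e i) = 1"
proof -
  have "(of_real ((norm (e i))\<^sup>2) :: 'k) = of_real 1"
    unfolding ip_self[symmetric] of_real_1 using orthonormalD[OF assms(1,2,2)] by simp
  then have "(norm (e i))\<^sup>2 = 1"
    by (simp only: of_real_eq_iff)
  then show ?thesis
    by (simp add: power2_eq_1_iff) (metis norm_ge_zero not_one_le_zero le_minus_one_simps(3))
qed

lemma ip_orthonormal_sum:
  assumes "orthonormal e I" "finite I" "j \<in> I"
  shows "ip (\<Sum>i\<in>I. sc (a i) (e i)) (e j) = a j"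
proof -
  have "ip (\<Sum>i\<in>I. sc (a i) (e i)) (e j) = (\<Sum>i\<in>I. if i = j then a i else 0)"
    unfolding ip.sum_left ip_scale_left
    using assms by (intro sum.cong) (auto simp: orthonormalD)
  then show ?thesis
    using assms by simp
qed

lemma norm_orthonormal_sum:
  assumes "orthonormal e I" "finite I"
  shows "(norm (\<Sum>i\<in>I. sc (a i) (e i)))\<^sup>2 = (\<Sum>i\<in>I. (norm (a i))\<^sup>2)"
proof -
  let ?s = "\<Sum>i\<in>I. sc (a i) (e i)"
  have "ip ?s ?s = (\<Sum>i\<in>I. scnj (a i) * ip ?s (e i))"
    by (subst ip.sum_right) (simp add: ip_scale_right)
  also have "\<dots> = (\<Sum>i\<in>I. scnj (a i) * a i)"
    by (intro sum.cong) (simp_all add: ip_orthonormal_sum[OF assms])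
  also have "\<dots> = of_real (\<Sum>i\<in>I. (norm (a i))\<^sup>2)"
    by (simp only: scnj_mult_self of_real_sum)
  finally show ?thesis
    by (simp only: ip_self of_real_eq_iff)
qed

lemma orthonormal_residual:
  assumes "orthonormal e I" "finite I" "j \<in> I"
  shows "ip (x - (\<Sum>i\<in>I. sc (ip x (e i)) (e i))) (e j) = 0"
  by (simp add: ip_diff_left ip_orthonormal_sum[OF assms])

text \<open>The residual is orthogonal to every \<open>e i\<close>, so Pythagoras separates it from
  the error in the coefficients. Taking \<open>a = 0\<close> yields Bessel's inequality; taking
  \<open>a\<close> supported on a subset shows that Fourier sums are best approximations.\<close>

lemma norm_residual_split:
  assumes "orthonormal e I" "finite I"
  shows "(norm (x - (\<Sum>i\<in>I. sc (a i) (e i))))\<^sup>2 =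
         (norm (x - (\<Sum>i\<in>I. sc (ip x (e i)) (e i))))\<^sup>2 + (\<Sum>i\<in>I. (norm (ip x (e i) - a i))\<^sup>2)"
proof -
  let ?r = "x - (\<Sum>i\<in>I. sc (ip x (e i)) (e i))"
  let ?d = "\<Sum>i\<in>I. sc (ip x (e i) - a i) (e i)"
  have "ip ?r ?d = 0"
    unfolding ip.sum_right ip_scale_right by (intro sum.neutral) (simp add: orthonormal_residual[OF assms])
  then have "(norm (?r + ?d))\<^sup>2 = (norm ?r)\<^sup>2 + (norm ?d)\<^sup>2"
    by (rule pythagoras)
  also have "?r + ?d = x - (\<Sum>i\<in>I. sc (a i) (e i))"
    by (simp add: scale_left_diff_distrib sum_subtractf)
  finally show ?thesis
    by (simp only: norm_orthonormal_sum[OF assms])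
qed

lemma norm_residual:
  assumes "orthonormal e I" "finite I"
  shows "(norm (x - (\<Sum>i\<in>I. sc (ip x (e i)) (e i))))\<^sup>2 = (norm x)\<^sup>2 - (\<Sum>i\<in>I. (norm (ip x (e i)))\<^sup>2)"
  using norm_residual_split[OF assms, of x "\<lambda>_. 0"] by simp

lemma Bessel:
  assumes "orthonormal e I" "finite I"
  shows "(\<Sum>i\<in>I. (norm (ip x (e i)))\<^sup>2) \<le> (norm x)\<^sup>2"
  using norm_residual[OF assms, of x] by (smt (verit) zero_le_power2)

lemma sum_ip_ip_le:
  assumes "orthonormal e I" "finite I"
  shows "(\<Sum>i\<in>I. norm (ip x (e i)) * norm (ip y (e i))) \<le> norm x * norm y"
proof -
  have "(\<Sum>i\<in>I. norm (ip x (e i)) * norm (ip y (e i))) \<le>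
        L2_set (\<lambda>i. norm (ip x (e i))) I * L2_set (\<lambda>i. norm (ip y (e i))) I"
    using L2_set_mult_ineq[of "\<lambda>i. norm (ip x (e i))" "\<lambda>i. norm (ip y (e i))" I] by simp
  also have "\<dots> \<le> norm x * norm y"
    unfolding L2_set_def
    by (intro mult_mono real_le_lsqrt Bessel[OF assms] sum_nonneg real_sqrt_ge_zero) auto
  finally show ?thesis .
qed

lemma norm_residual_mono:
  assumes "orthonormal e I" "finite I" "J \<subseteq> I"
  shows "norm (x - (\<Sum>i\<in>I. sc (ip x (e i)) (e i))) \<le> norm (x - (\<Sum>i\<in>J. sc (a i) (e i)))"
proof -
  have "(\<Sum>i\<in>J. sc (a i) (e i)) = (\<Sum>i\<in>I. sc (if i \<in> J then a i else 0) (e i))"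
    by (intro sum.mono_neutral_cong_left) (use assms in auto)
  then have "(norm (x - (\<Sum>i\<in>I. sc (ip x (e i)) (e i))))\<^sup>2 \<le> (norm (x - (\<Sum>i\<in>J. sc (a i) (e i))))\<^sup>2"
    using norm_residual_split[OF assms(1,2), of x "\<lambda>i. if i \<in> J then a i else 0"]
    by (simp add: sum_nonneg)
  then show ?thesis
    by (rule power2_le_imp_le) simp
qed

end

section \<open>Orthonormal expansions and the trace\<close>

context hilbert_space
begin

text \<open>The squared norm of a block of the series is the corresponding block of squared
  coefficients, so the Cauchy criterion carries over.\<close>

lemma summable_orthonormal:
  fixes e :: "nat \<Rightarrow> 'a"
  assumes e: "orthonormal e UNIV" and a: "summable (\<lambda>n. (norm (a n))\<^sup>2)"
  shows "summable (\<lambda>n. sc (a n) (e n))"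
  unfolding summable_Cauchy
proof (intro allI impI)
  fix r :: real
  assume "r > 0"
  then obtain N where N: "\<And>m n. m \<ge> N \<Longrightarrow> norm (\<Sum>i=m..<n. (norm (a i))\<^sup>2) < r\<^sup>2"
    using a[unfolded summable_Cauchy, rule_format, of "r\<^sup>2"] by auto
  have "norm (\<Sum>i=m..<n. sc (a i) (e i)) < r" if "m \<ge> N" for m n
  proof -
    have "(norm (\<Sum>i=m..<n. sc (a i) (e i)))\<^sup>2 = (\<Sum>i=m..<n. (norm (a i))\<^sup>2)"
      by (intro norm_orthonormal_sum orthonormal_mono[OF e]) auto
    also have "\<dots> < r\<^sup>2"
      using N[OF that, of n] by simp
    finally show ?thesis
      using \<open>r > 0\<close> by (simp add: power_less_imp_less_base)
  qed
  then show "\<exists>N. \<forall>m\<ge>N. \<forall>n. norm (\<Sum>i=m..<n. sc (a i) (e i)) < r"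
    by blast
qed

lemma ip_orthonormal_sums:
  fixes e :: "nat \<Rightarrow> 'a"
  assumes e: "orthonormal e UNIV" and x: "(\<lambda>n. sc (a n) (e n)) sums x"
  shows "ip x (e j) = a j"
proof -
  have "(\<lambda>n. ip (sc (a n) (e n)) (e j)) sums ip x (e j)"
    by (rule bounded_linear.sums[OF ip.bounded_linear_left x])
  moreover have "ip (sc (a n) (e n)) (e j) = (if n = j then a j else 0)" for n
    using orthonormalD[OF e, of n j] by (simp add: ip_scale_left)
  ultimately have "(\<lambda>n. if n = j then a j else 0) sums ip x (e j)"
    by simp
  then show ?thesis
    using sums_single[of j "\<lambda>_. a j"] sums_unique2 by blast
qed

lemma norm_orthonormal_sums:
  fixes e :: "nat \<Rightarrow> 'a"
  assumes e: "orthonormal e UNIV" and x: "(\<lambda>n. sc (a n) (e n)) sums x"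
  shows "(\<lambda>n. (norm (a n))\<^sup>2) sums (norm x)\<^sup>2"
proof -
  have "(\<lambda>n. (norm (\<Sum>i<n. sc (a i) (e i)))\<^sup>2) \<longlonglongrightarrow> (norm x)\<^sup>2"
    using x unfolding sums_def by (intro tendsto_intros)
  then show ?thesis
    unfolding sums_def norm_orthonormal_sum[OF orthonormal_mono[OF e subset_UNIV] finite_lessThan] .
qed

lemma
  fixes e :: "nat \<Rightarrow> 'a"
  assumes e: "orthonormal e UNIV"
  shows summable_Bessel: "summable (\<lambda>n. (norm (ip x (e n)))\<^sup>2)"
    and suminf_Bessel: "(\<Sum>n. (norm (ip x (e n)))\<^sup>2) \<le> (norm x)\<^sup>2"
proof -
  have *: "(\<Sum>i<n. (norm (ip x (e i)))\<^sup>2) \<le> (norm x)\<^sup>2" for n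
    by (intro Bessel orthonormal_mono[OF e]) auto
  show **: "summable (\<lambda>n. (norm (ip x (e n)))\<^sup>2)"
    by (rule summableI_nonneg_bounded[where x = "(norm x)\<^sup>2"]) (use * in auto)
  show "(\<Sum>n. (norm (ip x (e n)))\<^sup>2) \<le> (norm x)\<^sup>2"
    by (rule suminf_le_const[OF ** *])
qed

lemma orthonormal_shift: "orthonormal e UNIV \<Longrightarrow> orthonormal (\<lambda>n. e (n + M)) (UNIV :: nat set)"
  by (simp add: orthonormal_def)

section \<open>Bounded operators and partial isometries\<close>

lemma bounded_operatorsI:
  assumes "\<And>x y. D (x + y) = D x + D y" "\<And>c x. D (sc c x) = sc c (D x)" "\<And>x. norm (D x) \<le> C * norm x"
  shows "D \<in> bounded_operators sc"
  using assms vector_space_axioms unfolding bounded_operators_def Vector_Spaces.linear_iff by blast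

lemma
  assumes "D \<in> bounded_operators sc"
  shows bounded_operator_add: "D (x + y) = D x + D y"
    and bounded_operator_scale: "D (sc c x) = sc c (D x)"
    and bounded_operator_bounded_linear: "bounded_linear D"
proof -
  obtain C where C: "\<And>x. norm (D x) \<le> C * norm x"
    using assms unfolding bounded_operators_def by blast
  show *: "D (x + y) = D x + D y" "D (sc c x) = sc c (D x)" for x y c
    using assms unfolding bounded_operators_def Vector_Spaces.linear_iff by blast+
  show "bounded_linear D"
    by (rule bounded_linear_intro[where K = C]) (simp_all add: * scaleR_sc C mult.commute)
qed

lemma bounded_operators_plus:
  assumes "D \<in> bounded_operators sc" "E \<in> bounded_operators sc"
  shows "(\<lambda>x. D x + E x) \<in> bounded_operators sc"
proof -
  obtain C where "\<forall>x. norm (D x + E x) \<le> norm x * C"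
    using bounded_linear.bounded[OF bounded_linear_add[OF assms[THEN bounded_operator_bounded_linear]]] by blast
  then show ?thesis
    by (intro bounded_operatorsI[where C = C])
       (simp_all add: assms bounded_operator_add bounded_operator_scale scale_right_distrib algebra_simps)
qed

lemma bounded_operators_scale:
  assumes "D \<in> bounded_operators sc"
  shows "(\<lambda>x. sc c (D x)) \<in> bounded_operators sc"
proof -
  obtain C where "\<forall>x. norm (sc c (D x)) \<le> norm x * C"
    using bounded_linear.bounded[OF bounded_linear_compose[OF sc.bounded_linear_right bounded_operator_bounded_linear[OF assms]]]
    by blast
  then show ?thesis
    by (intro bounded_operatorsI[where C = C])
       (simp_all add: assms bounded_operator_add bounded_operator_scale scale_right_distrib scale_left_commute mult.commute)
qed

lemma bounded_operators_compose:
  assumes "D \<in> bounded_operators sc" "E \<in> bounded_operators sc"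
  shows "(\<lambda>x. D (E x)) \<in> bounded_operators sc"
proof -
  obtain C where "\<forall>x. norm (D (E x)) \<le> norm x * C"
    using bounded_linear.bounded[OF bounded_linear_compose[OF assms[THEN bounded_operator_bounded_linear]]] by blast
  then show ?thesis
    by (intro bounded_operatorsI[where C = C])
       (simp_all add: assms bounded_operator_add bounded_operator_scale mult.commute)
qed

lemma bounded_operators_id: "(\<lambda>x. x) \<in> bounded_operators sc"
  by (rule bounded_operatorsI[where C = 1]) auto

text \<open>For orthonormal \<open>u\<close> and \<open>v\<close> this sends \<open>u n\<close> to
  \<open>v n\<close> and kills the orthogonal complement of \<open>u\<close>. It is a projection
  when \<open>u = v\<close>, and a backward shift when \<open>u n = v (n + M)\<close>.\<close>

definition partial_isometry :: "(nat \<Rightarrow> 'a) \<Rightarrow> (nat \<Rightarrow> 'a) \<Rightarrow> 'a \<Rightarrow> 'a" where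
  "partial_isometry u v x = (\<Sum>n. sc (ip x (u n)) (v n))"

context
  fixes u v :: "nat \<Rightarrow> 'a"
  assumes u: "orthonormal u UNIV" and v: "orthonormal v UNIV"
begin

lemma partial_isometry_sums: "(\<lambda>n. sc (ip x (u n)) (v n)) sums partial_isometry u v x"
  unfolding partial_isometry_def
  by (intro summable_sums summable_orthonormal[OF v] summable_Bessel[OF u])

lemma partial_isometry_eqI: "(\<lambda>n. sc (ip x (u n)) (v n)) sums y \<Longrightarrow> partial_isometry u v x = y"
  using partial_isometry_sums sums_unique2 by blast

lemma norm_partial_isometry: "norm (partial_isometry u v x) \<le> norm x"
proof -
  have "(norm (partial_isometry u v x))\<^sup>2 = (\<Sum>n. (norm (ip x (u n)))\<^sup>2)"
    by (rule sums_unique[OF norm_orthonormal_sums[OF v partial_isometry_sums]])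
  also have "\<dots> \<le> (norm x)\<^sup>2"
    by (rule suminf_Bessel[OF u])
  finally show ?thesis
    by (rule power2_le_imp_le) simp
qed

lemma partial_isometry_bounded_operator: "partial_isometry u v \<in> bounded_operators sc"
proof (rule bounded_operatorsI[where C = 1])
  show "partial_isometry u v (x + y) = partial_isometry u v x + partial_isometry u v y" for x y
    using sums_add[OF partial_isometry_sums[of x] partial_isometry_sums[of y]]
    by (intro partial_isometry_eqI) (simp add: ip_add_left scale_left_distrib)
  show "partial_isometry u v (sc c x) = sc c (partial_isometry u v x)" for c x
    using bounded_linear.sums[OF sc.bounded_linear_right partial_isometry_sums[of x]]
    by (intro partial_isometry_eqI) (simp add: ip_scale_left)
qed (simp add: norm_partial_isometry)

end

text \<open>A point of the span close to \<open>x\<close> involves finitely many basis vectors; by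
  best approximation every Fourier sum over a larger finite set is at least as close. The sum is
  unordered because \<open>E\<close> may be uncountable.\<close>

lemma fourier_has_sum:
  assumes E: "orthonormal (\<lambda>e. e) E" and x: "x \<in> closure (span E)"
  shows "((\<lambda>e. sc (ip x e) e) has_sum x) E"
  unfolding has_sum_def tendsto_iff eventually_finite_subsets_at_top
proof (intro allI impI)
  fix r :: real
  assume "r > 0"
  then obtain y where "y \<in> span E" and y: "dist y x < r"
    using x unfolding closure_approachable by blast
  then obtain t a where t: "finite t" "t \<subseteq> E" and y_eq: "y = (\<Sum>e\<in>t. sc (a e) e)"
    unfolding span_explicit by blast
  have "dist (\<Sum>e\<in>Y. sc (ip x e) e) x < r" if Y: "finite Y" "t \<subseteq> Y" "Y \<subseteq> E" for Y
  proof -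
    have "dist (\<Sum>e\<in>Y. sc (ip x e) e) x = norm (x - (\<Sum>e\<in>Y. sc (ip x e) e))"
      by (simp add: dist_norm norm_minus_commute)
    also have "\<dots> \<le> norm (x - y)"
      unfolding y_eq using Y
      by (intro norm_residual_mono[where e = "\<lambda>e. e"] orthonormal_mono[OF E])
    finally show ?thesis
      using y by (simp add: dist_norm norm_minus_commute)
  qed
  with t show "\<exists>X. finite X \<and> X \<subseteq> E \<and>
      (\<forall>Y. finite Y \<and> X \<subseteq> Y \<and> Y \<subseteq> E \<longrightarrow> dist (\<Sum>e\<in>Y. sc (ip x e) e) x < r)"
    by blast
qed

text \<open>The difference between \<open>x\<close> and its nearest point in \<open>V\<close>,
  normalised. The nearest point is the limit of a minimising sequence.\<close>

lemma exists_orthogonal_unit: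
  assumes V: "subspace V" "closed V" and x: "x \<notin> V"
  shows "\<exists>u. norm u = 1 \<and> (\<forall>v\<in>V. ip u v = 0)"
proof -
  define d where "d = (INF v\<in>V. (norm (x - v))\<^sup>2)"
  have ne: "V \<noteq> {}"
    using subspace_0[OF V(1)] by blast
  have d_le: "d \<le> (norm (x - v))\<^sup>2" if "v \<in> V" for v
    unfolding d_def by (rule cINF_lower[OF bdd_belowI2[where m = 0] that]) simp
  have "\<exists>v\<in>V. (norm (x - v))\<^sup>2 < d + 1 / real (Suc n)" for n
    using cINF_less_iff[OF ne bdd_belowI2[where m = 0], of "\<lambda>v. (norm (x - v))\<^sup>2" "d + 1 / real (Suc n)"]
    by (simp add: d_def)
  then obtain v where v: "\<And>n. v n \<in> V" "\<And>n. (norm (x - v n))\<^sup>2 < d + 1 / real (Suc n)"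
    by metis
  have lim: "(\<lambda>n. (norm (x - v n))\<^sup>2) \<longlonglongrightarrow> d"
  proof (rule tendsto_sandwich[OF _ _ tendsto_const])
    show "\<forall>\<^sub>F n in sequentially. d \<le> (norm (x - v n))\<^sup>2"
      using v(1) d_le by simp
    show "\<forall>\<^sub>F n in sequentially. (norm (x - v n))\<^sup>2 \<le> d + 1 / real (Suc n)"
      using v(2) by (simp add: less_imp_le)
    show "(\<lambda>n. d + 1 / real (Suc n)) \<longlonglongrightarrow> d"
      using tendsto_add[OF tendsto_const lim_1_over_n[THEN LIMSEQ_Suc], of d] by simp
  qed
  have "Cauchy v"
  proof (rule metric_CauchyI)
    fix r :: real
    assume "r > 0"
    then have "\<forall>\<^sub>F n in sequentially. (norm (x - v n))\<^sup>2 < d + r\<^sup>2 / 4"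
      by (intro order_tendstoD[OF lim]) simp
    then obtain N where N: "\<And>n. n \<ge> N \<Longrightarrow> (norm (x - v n))\<^sup>2 < d + r\<^sup>2 / 4"
      unfolding eventually_sequentially by blast
    have "dist (v m) (v n) < r" if "m \<ge> N" "n \<ge> N" for m n
    proof -
      \<comment> \<open>The midpoint cannot be closer than the infimum, so the sum in the
        parallelogram law has squared norm at least \<open>4 * d\<close>. The right side is below
        \<open>4 * d + r^2\<close>, which leaves less than \<open>r^2\<close> for the
        difference.\<close>
      have "(1/2) *\<^sub>R (v m + v n) \<in> V"
        unfolding scaleR_sc by (intro subspace_scale subspace_add V v)
      then have "4 * d \<le> 4 * (norm (x - (1/2) *\<^sub>R (v m + v n)))\<^sup>2"
        using d_le by simp
      also have "\<dots> = (norm (2 *\<^sub>R (x - (1/2) *\<^sub>R (v m + v n))))\<^sup>2"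
        unfolding norm_scaleR by (simp add: power_mult_distrib)
      also have "2 *\<^sub>R (x - (1/2) *\<^sub>R (v m + v n)) = (x - v m) + (x - v n)"
        by (simp add: scaleR_diff_right scaleR_2)
      finally have "(norm ((x - v m) - (x - v n)))\<^sup>2 < r\<^sup>2"
        using parallelogram[of "x - v m" "x - v n"] N[OF that(1)] N[OF that(2)] by linarith
      then have "norm (v m - v n) < r"
        using \<open>r > 0\<close> by (simp add: power_less_imp_less_base norm_minus_commute)
      then show ?thesis
        by (simp add: dist_norm)
    qed
    then show "\<exists>N. \<forall>m\<ge>N. \<forall>n\<ge>N. dist (v m) (v n) < r"
      by blast
  qed
  then obtain w where w: "v \<longlonglongrightarrow> w"
    using Cauchy_convergent_iff convergent_def by blast
  have "w \<in> V"
    using closed_sequentially[OF V(2) _ w] v(1) by blast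
  have "(norm (x - w))\<^sup>2 = d"
    by (rule LIMSEQ_unique[OF _ lim]) (intro tendsto_intros w)
  have orth: "ip (x - w) z = 0" if z: "z \<in> V" for z
  proof (cases "z = 0")
    case False
    \<comment> \<open>Moving \<open>w\<close> by the projection of \<open>x - w\<close> onto
      \<open>z\<close> would lower the minimal squared distance unless \<open>ip (x - w) z\<close>
      is zero.\<close>
    define c where "c = ip (x - w) z / of_real ((norm z)\<^sup>2)"
    have "d \<le> (norm (x - (w + sc c z)))\<^sup>2"
      by (intro d_le subspace_add subspace_scale V z \<open>w \<in> V\<close>)
    also have "x - (w + sc c z) = (x - w) - sc c z"
      by simp
    also have "(norm ((x - w) - sc c z))\<^sup>2 = d - (norm (ip (x - w) z))\<^sup>2 / (norm z)\<^sup>2"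
      unfolding c_def norm_diff_projection[OF False] \<open>(norm (x - w))\<^sup>2 = d\<close> ..
    finally have "(norm (ip (x - w) z))\<^sup>2 / (norm z)\<^sup>2 \<le> 0"
      by simp
    then show ?thesis
      using False by (simp add: divide_le_0_iff)
  qed simp
  have "x \<noteq> w"
    using x \<open>w \<in> V\<close> by blast
  then have "norm ((1 / norm (x - w)) *\<^sub>R (x - w)) = 1"
    by simp
  moreover have "\<forall>z\<in>V. ip ((1 / norm (x - w)) *\<^sub>R (x - w)) z = 0"
    unfolding ip_scaleR_left using orth by simp
  ultimately show ?thesis
    by blast
qed

lemma subspace_closure:
  assumes "subspace V"
  shows "subspace (closure V)"
proof (rule subspaceI)
  show "0 \<in> closure V"
    using closure_subset subspace_0[OF assms] by blast
  show "x + y \<in> closure V" if "x \<in> closure V" "y \<in> closure V" for x y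
  proof -
    obtain a b where a: "\<And>n. a n \<in> V" "a \<longlonglongrightarrow> x" and b: "\<And>n. b n \<in> V" "b \<longlonglongrightarrow> y"
      using \<open>x \<in> closure V\<close> \<open>y \<in> closure V\<close> unfolding closure_sequential by blast
    have "(\<lambda>n. a n + b n) \<longlonglongrightarrow> x + y" "\<And>n. a n + b n \<in> V"
      by (auto intro!: tendsto_add a b subspace_add assms)
    then show ?thesis
      unfolding closure_sequential by (intro exI[of _ "\<lambda>n. a n + b n"] conjI allI)
  qed
  show "sc c x \<in> closure V" if x: "x \<in> closure V" for c x
  proof -
    obtain a where a: "\<And>n. a n \<in> V" "a \<longlonglongrightarrow> x"
      using x unfolding closure_sequential by blast
    have "(\<lambda>n. sc c (a n)) \<longlonglongrightarrow> sc c x" "\<And>n. sc c (a n) \<in> V"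
      by (auto intro!: sc.tendsto tendsto_const a subspace_scale assms)
    then show ?thesis
      unfolding closure_sequential by (intro exI[of _ "\<lambda>n. sc c (a n)"] conjI allI)
  qed
qed

text \<open>By Zorn's lemma there is a maximal orthonormal set; were its span not dense, a unit
  vector orthogonal to it could be added. This makes the choice of a basis in
  \<open>operator_trace\<close> meaningful.\<close>

lemma exists_orthonormal_basis: "\<exists>E. orthonormal_basis sc ip E"
proof -
  let ?\<O> = "{E. orthonormal (\<lambda>e. e) E}"
  have "\<exists>E\<in>?\<O>. \<forall>X\<in>?\<O>. E \<subseteq> X \<longrightarrow> X = E"
  proof (rule subset_Zorn_nonempty)
    show "?\<O> \<noteq> {}"
    proof -
      have "orthonormal (\<lambda>e. e) {}"
        by (simp add: orthonormal_def)
      then show ?thesis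
        by blast
    qed
    fix \<C>
    assume "\<C> \<noteq> {}" and chain: "subset.chain ?\<O> \<C>"
    have "ip e f = (if e = f then 1 else 0)" if ef: "e \<in> \<Union>\<C>" "f \<in> \<Union>\<C>" for e f
    proof -
      obtain X where "X \<in> \<C>" "e \<in> X" "f \<in> X"
        using ef chain unfolding subset_chain_def by blast
      moreover have "orthonormal (\<lambda>e. e) X"
        using \<open>X \<in> \<C>\<close> chain unfolding subset_chain_def by blast
      ultimately show ?thesis
        using orthonormalD[of "\<lambda>e. e" X e f] by simp
    qed
    then show "\<Union>\<C> \<in> ?\<O>"
      by (auto simp: orthonormal_def)
  qed
  then obtain E where E: "orthonormal (\<lambda>e. e) E"
    and max: "\<And>X. orthonormal (\<lambda>e. e) X \<Longrightarrow> E \<subseteq> X \<Longrightarrow> X = E"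
    by blast
  have "x \<in> closure (span E)" for x
  proof (rule ccontr)
    assume "x \<notin> closure (span E)"
    then obtain u where u: "norm u = 1" "\<And>v. v \<in> closure (span E) \<Longrightarrow> ip u v = 0"
      using exists_orthogonal_unit[OF subspace_closure[OF subspace_span] closed_closure] by blast
    have E0: "ip u e = 0" "ip e u = 0" if "e \<in> E" for e
      using u(2) closure_subset span_base[OF that] ip_eq_0_commute[of u e] by blast+
    have uu: "ip u u = 1"
      using u(1) by (simp add: ip_self)
    have "u \<notin> E"
      using E0 uu by fastforce
    have "orthonormal (\<lambda>e. e) (insert u E)"
      using E E0 uu \<open>u \<notin> E\<close> unfolding orthonormal_def by auto
    then show False
      using max \<open>u \<notin> E\<close> by blast
  qed
  then show ?thesis
    using E unfolding orthonormal_basis_def orthonormal_def by blast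
qed

text \<open>The trace is a double sum over the basis and the rank-one terms of \<open>T\<close>. It
  converges absolutely, so the order may be exchanged, and summing over the basis first leaves one
  inner product per rank-one term. All later facts about traces are read off this series.\<close>

lemma operator_trace_nuclear:
  fixes x y :: "nat \<Rightarrow> 'a"
  assumes xy: "summable (\<lambda>n. norm (x n) * norm (y n))"
    and T: "\<And>h. (\<lambda>n. sc (ip h (y n)) (x n)) sums T h"
    and D: "D \<in> bounded_operators sc"
  shows "operator_trace sc ip (D \<circ> T) = (\<Sum>n. ip (D (x n)) (y n))"
proof -
  define E where "E = (SOME E. orthonormal_basis sc ip E)"
  have "orthonormal_basis sc ip E"
    unfolding E_def by (rule someI_ex[OF exists_orthonormal_basis])
  then have E: "orthonormal (\<lambda>e. e) E" and dense: "closure (span E) = UNIV"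
    unfolding orthonormal_basis_def orthonormal_def by blast+
  interpret D: bounded_linear D
    by (rule bounded_operator_bounded_linear[OF D])
  obtain C where C: "\<And>z. norm (D z) \<le> norm z * C" "C \<ge> 0"
    using D.nonneg_bounded by blast
  \<comment> \<open>The diagonal entry at \<open>e\<close> of the \<open>n\<close>-th rank-one term
    of \<open>D \<circ> T\<close>.\<close>
  define f where "f = (\<lambda>n e. ip e (y n) * ip (D (x n)) e)"
  have summ: "(\<lambda>n. norm (D (x n)) * norm (y n)) summable_on UNIV"
  proof -
    have "summable (\<lambda>n. norm (D (x n)) * norm (y n))"
    proof (rule summable_comparison_test'[OF summable_mult[OF xy, of C], where N = 0])
      show "norm (norm (D (x n)) * norm (y n)) \<le> C * (norm (x n) * norm (y n))" for n
        using mult_right_mono[OF C(1), of "norm (y n)" "x n"] by (simp add: mult_ac)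
    qed
    then show ?thesis
      by (intro summable_nonneg_imp_summable_on) auto
  qed
  have abs: "(\<lambda>(n, e). f n e) abs_summable_on (UNIV \<times> E)"
    unfolding abs_summable_iff_bdd_above
  proof (rule bdd_aboveI2)
    fix F :: "(nat \<times> 'a) set"
    assume "F \<in> {F. F \<subseteq> UNIV \<times> E \<and> finite F}"
    then have F: "F \<subseteq> fst ` F \<times> snd ` F" "snd ` F \<subseteq> E" "finite F"
      by force+
    \<comment> \<open>Enlarging \<open>F\<close> to a product of finite sets allows
      \<open>sum_ip_ip_le\<close> to bound the sum over \<open>e\<close> separately for each
      \<open>n\<close>.\<close>
    have "(\<Sum>p\<in>F. norm (case p of (n, e) \<Rightarrow> f n e)) \<le> (\<Sum>p\<in>fst ` F \<times> snd ` F. norm (case p of (n, e) \<Rightarrow> f n e))"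
      using F by (intro sum_mono2) auto
    also have "\<dots> = (\<Sum>n\<in>fst ` F. \<Sum>e\<in>snd ` F. norm (f n e))"
      by (simp add: sum.cartesian_product split_def)
    also have "\<dots> \<le> (\<Sum>n\<in>fst ` F. norm (D (x n)) * norm (y n))"
    proof (rule sum_mono)
      fix n
      have "norm (f n e) = norm (ip (D (x n)) e) * norm (ip (y n) e)" for e
        using ip_commute[of e "y n"] by (simp add: f_def norm_mult mult.commute)
      then show "(\<Sum>e\<in>snd ` F. norm (f n e)) \<le> norm (D (x n)) * norm (y n)"
        using sum_ip_ip_le[OF orthonormal_mono[OF E F(2)], of "D (x n)" "y n"] F(3) by simp
    qed
    also have "\<dots> \<le> (\<Sum>\<^sub>\<infinity>n. norm (D (x n)) * norm (y n))"
      using summ F(3) by (intro finite_sum_le_infsum) auto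
    finally show "(\<Sum>p\<in>F. norm (case p of (n, e) \<Rightarrow> f n e)) \<le> (\<Sum>\<^sub>\<infinity>n. norm (D (x n)) * norm (y n))" .
  qed
  then have "infsum (\<lambda>n. infsum (f n) E) UNIV = infsum (\<lambda>e. infsum (\<lambda>n. f n e) UNIV) E"
    by (rule infsum_swap_banach[OF abs_summable_summable])
  moreover have "infsum (\<lambda>n. f n e) UNIV = ip ((D \<circ> T) e) e" if "e \<in> E" for e
  proof -
    have "(\<lambda>n. f n e) abs_summable_on UNIV"
    proof -
      have "(\<lambda>(n, e). f n e) abs_summable_on (\<lambda>n. (n, e)) ` UNIV"
        using abs by (rule summable_on_subset_banach) (use that in auto)
      then show ?thesis
        by (subst (asm) summable_on_reindex) (auto simp: inj_on_def o_def)
    qed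
    then have "(\<lambda>n. f n e) sums infsum (\<lambda>n. f n e) UNIV"
      by (rule has_sum_imp_sums[OF has_sum_infsum[OF abs_summable_summable]])
    moreover have "(\<lambda>n. f n e) sums ip (D (T e)) e"
      using bounded_linear.sums[OF ip.bounded_linear_left D.sums[OF T[of e]]]
      by (simp add: f_def bounded_operator_scale[OF D] ip_scale_left)
    ultimately show ?thesis
      using sums_unique2 by fastforce
  qed
  ultimately have "operator_trace sc ip (D \<circ> T) = infsum (\<lambda>n. infsum (f n) E) UNIV"
    unfolding operator_trace_def E_def[symmetric] by (simp cong: infsum_cong)
  also have "\<dots> = infsum (\<lambda>n. ip (D (x n)) (y n)) UNIV"
  proof (intro infsum_cong infsumI)
    show "(f n has_sum ip (D (x n)) (y n)) E" for n
      using has_sum_bounded_linear[OF ip.bounded_linear_left fourier_has_sum[OF E, of "D (x n)"], of "y n"]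
      by (simp add: dense f_def ip_scale_left mult.commute)
  qed
  also have "\<dots> = (\<Sum>n. ip (D (x n)) (y n))"
  proof -
    have "(\<lambda>n. ip (D (x n)) (y n)) abs_summable_on UNIV"
      by (rule summable_on_comparison_test[OF summ]) (auto intro: Cauchy_Schwarz)
    then show ?thesis
      by (rule sums_unique[OF has_sum_imp_sums[OF has_sum_infsum[OF abs_summable_summable]]])
  qed
  finally show ?thesis .
qed

end

section \<open>The ultraweak topology and interpolation of traces\<close>

context hilbert_space
begin

section \<open>Traces as functionals of the operator\<close>

lemma nuclear_zero: "nuclear sc ip (\<lambda>_. 0)"
  unfolding nuclear_def by (rule exI[of _ "\<lambda>_. 0"], rule exI[of _ "\<lambda>_. 0"]) simp

lemma operator_trace_nuclear_representation:
  assumes "nuclear sc ip T"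
  shows "\<exists>x y :: nat \<Rightarrow> 'a. summable (\<lambda>n. norm (x n) * norm (y n)) \<and>
    (\<forall>D\<in>bounded_operators sc. operator_trace sc ip (D \<circ> T) = (\<Sum>n. ip (D (x n)) (y n)))"
  using assms operator_trace_nuclear unfolding nuclear_def by blast

lemma summable_ip_bounded_operator:
  fixes x y :: "nat \<Rightarrow> 'a"
  assumes xy: "summable (\<lambda>n. norm (x n) * norm (y n))" and D: "D \<in> bounded_operators sc"
  shows "summable (\<lambda>n. ip (D (x n)) (y n))"
proof -
  obtain C where C: "\<And>z. norm (D z) \<le> norm z * C"
    using bounded_linear.bounded[OF bounded_operator_bounded_linear[OF D]] by blast
  show ?thesis
  proof (rule summable_comparison_test'[OF summable_mult[OF xy, of C], where N = 0])
    show "norm (ip (D (x n)) (y n)) \<le> C * (norm (x n) * norm (y n))" for n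
      using Cauchy_Schwarz[of "D (x n)" "y n"] mult_right_mono[OF C, of "norm (y n)" "x n"]
      by (simp add: mult_ac)
  qed
qed

context
  fixes T
  assumes T: "nuclear sc ip T"
begin

lemma operator_trace_plus:
  assumes "D \<in> bounded_operators sc" "E \<in> bounded_operators sc"
  shows "operator_trace sc ip ((\<lambda>x. D x + E x) \<circ> T) = operator_trace sc ip (D \<circ> T) + operator_trace sc ip (E \<circ> T)"
proof -
  obtain x y :: "nat \<Rightarrow> 'a" where "summable (\<lambda>n. norm (x n) * norm (y n))"
    and "\<And>D. D \<in> bounded_operators sc \<Longrightarrow> operator_trace sc ip (D \<circ> T) = (\<Sum>n. ip (D (x n)) (y n))"
    using operator_trace_nuclear_representation[OF T] by blast
  then show ?thesis
    using assms by (simp add: bounded_operators_plus ip_add_left suminf_add summable_ip_bounded_operator)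
qed

lemma operator_trace_scale:
  assumes "D \<in> bounded_operators sc"
  shows "operator_trace sc ip ((\<lambda>x. sc c (D x)) \<circ> T) = c * operator_trace sc ip (D \<circ> T)"
proof -
  obtain x y :: "nat \<Rightarrow> 'a" where "summable (\<lambda>n. norm (x n) * norm (y n))"
    and "\<And>D. D \<in> bounded_operators sc \<Longrightarrow> operator_trace sc ip (D \<circ> T) = (\<Sum>n. ip (D (x n)) (y n))"
    using operator_trace_nuclear_representation[OF T] by blast
  then show ?thesis
    using assms by (simp add: bounded_operators_scale ip_scale_left suminf_mult summable_ip_bounded_operator)
qed

text \<open>Bounded pointwise convergence implies ultraweak convergence: each term of the trace
  series converges, and \<open>B * C * (norm (x n) * norm (y n))\<close> is a summable majorant
  independent of \<open>N\<close>, so Tannery's theorem applies.\<close>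

lemma tendsto_operator_trace:
  assumes D: "D \<in> bounded_operators sc" and Q: "\<And>N::nat. Q N \<in> bounded_operators sc"
    and bound: "\<And>N x. norm (Q N x) \<le> C * norm x" and lim: "\<And>x. (\<lambda>N. Q N x) \<longlonglongrightarrow> x"
  shows "(\<lambda>N. operator_trace sc ip ((\<lambda>x. D (Q N x)) \<circ> T)) \<longlonglongrightarrow> operator_trace sc ip (D \<circ> T)"
proof -
  obtain x y :: "nat \<Rightarrow> 'a" where xy: "summable (\<lambda>n. norm (x n) * norm (y n))"
    and tr: "\<And>D. D \<in> bounded_operators sc \<Longrightarrow> operator_trace sc ip (D \<circ> T) = (\<Sum>n. ip (D (x n)) (y n))"
    using operator_trace_nuclear_representation[OF T] by blast
  interpret D: bounded_linear D
    by (rule bounded_operator_bounded_linear[OF D])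
  obtain B where B: "\<And>z. norm (D z) \<le> norm z * B" "B \<ge> 0"
    using D.nonneg_bounded by blast
  have "(\<lambda>N. \<Sum>n. ip (D (Q N (x n))) (y n)) \<longlonglongrightarrow> (\<Sum>n. ip (D (x n)) (y n))"
  proof (rule tannerys_theorem[THEN conjunct2, THEN conjunct2])
    show "(\<lambda>N. ip (D (Q N (x n))) (y n)) \<longlonglongrightarrow> ip (D (x n)) (y n)" for n
      by (intro ip.tendsto tendsto_const D.tendsto lim)
    have "norm (ip (D (Q N (x n))) (y n)) \<le> B * C * (norm (x n) * norm (y n))" for N n
    proof -
      have "norm (D (Q N (x n))) \<le> (C * norm (x n)) * B"
        using B(1)[of "Q N (x n)"] mult_right_mono[OF bound B(2)] order_trans by blast
      then have "norm (D (Q N (x n))) * norm (y n) \<le> (C * norm (x n)) * B * norm (y n)"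
        by (rule mult_right_mono) simp
      then show ?thesis
        using Cauchy_Schwarz[of "D (Q N (x n))" "y n"] by (simp add: mult_ac)
    qed
    then show "\<forall>\<^sub>F (n, N) in sequentially \<times>\<^sub>F sequentially.
        norm (ip (D (Q N (x n))) (y n)) \<le> B * C * (norm (x n) * norm (y n))"
      by (intro always_eventually) auto
  qed (use xy in auto)
  then show ?thesis
    by (simp add: tr bounded_operators_compose[OF D Q] D)
qed

end

text \<open>The tail projection is subtracted, instead of projecting onto the first \<open>M\<close>
  axes, so that the component orthogonal to all axes survives. Hence the cut-offs tend to the
  identity even if \<open>e\<close> is not complete.\<close>

definition cut_off :: "(nat \<Rightarrow> 'a) \<Rightarrow> nat \<Rightarrow> 'a \<Rightarrow> 'a" where
  "cut_off e M x = x - partial_isometry (\<lambda>n. e (n + M)) (\<lambda>n. e (n + M)) x"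

definition vanishing_from :: "(nat \<Rightarrow> 'a) \<Rightarrow> nat \<Rightarrow> ('a \<Rightarrow> 'a) set" where
  "vanishing_from e M = {F \<in> bounded_operators sc. \<forall>k\<ge>M. F (e k) = 0}"

lemma partial_isometry_basis:
  assumes e: "orthonormal e UNIV" and v: "orthonormal v UNIV"
  shows "partial_isometry e v (e k) = v k"
proof (rule partial_isometry_eqI[OF e v])
  have "sc (ip (e k) (e n)) (v n) = (if n = k then v k else 0)" for n
    using orthonormalD[OF e, of k n] by simp
  then show "(\<lambda>n. sc (ip (e k) (e n)) (v n)) sums v k"
    using sums_single[of k "\<lambda>_. v k"] by simp
qed

context
  fixes e :: "nat \<Rightarrow> 'a"
  assumes e: "orthonormal e UNIV"
begin

lemma cut_off_bounded_operator: "cut_off e M \<in> bounded_operators sc"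
  using bounded_operators_plus[OF bounded_operators_id bounded_operators_scale[OF
      partial_isometry_bounded_operator[OF orthonormal_shift[OF e] orthonormal_shift[OF e]], of "-1" M M]]
  unfolding cut_off_def by (simp add: scale_minus_left)

text \<open>The triangle inequality gives the crude constant 2; what
  \<open>tendsto_operator_trace\<close> asks for is a bound uniform in \<open>M\<close>.\<close>

lemma norm_cut_off: "norm (cut_off e M x) \<le> 2 * norm x"
  unfolding cut_off_def
  using norm_triangle_ineq4[of x] norm_partial_isometry[OF orthonormal_shift[OF e] orthonormal_shift[OF e], of M M x]
  by (smt (verit))

lemma cut_off_basis:
  assumes "k \<ge> M"
  shows "cut_off e M (e k) = 0"
  using partial_isometry_basis[OF orthonormal_shift[OF e] orthonormal_shift[OF e], of M M "k - M"] assms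
  by (simp add: cut_off_def)

lemma cut_off_tendsto: "(\<lambda>M. cut_off e M x) \<longlonglongrightarrow> x"
proof -
  have "(\<lambda>M. \<Sum>n. sc (ip x (e (n + M))) (e (n + M))) \<longlonglongrightarrow> 0"
    by (rule suminf_exist_split2[OF summable_orthonormal[OF e summable_Bessel[OF e]]])
  from tendsto_diff[OF tendsto_const this, of x] show ?thesis
    by (simp add: cut_off_def partial_isometry_def)
qed

text \<open>
  \<open>D \<circ> cut_off e N\<close> converges ultraweakly to \<open>D\<close>, so a functional that does not vanish on all
  bounded operators already does not vanish on some \<open>vanishing_from e N\<close>. The convergence in the last
  clause carries this through the induction.
\<close>

lemma trace_interpolation:
  assumes "finite \<T>" "\<forall>T\<in>\<T>. nuclear sc ip T"
  shows "\<exists>M R. \<forall>D\<in>bounded_operators sc. R D \<in> vanishing_from e M \<and>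
    (\<forall>T\<in>\<T>. operator_trace sc ip (R D \<circ> T) = operator_trace sc ip (D \<circ> T)) \<and>
    (\<forall>T. nuclear sc ip T \<longrightarrow>
       (\<lambda>N. operator_trace sc ip (R (\<lambda>x. D (cut_off e N x)) \<circ> T)) \<longlonglongrightarrow> operator_trace sc ip (R D \<circ> T))"
  using assms
proof (induction \<T> rule: finite_induct)
  case empty
  have "(\<lambda>_. 0) \<in> vanishing_from e 0"
    unfolding vanishing_from_def by (auto intro: bounded_operatorsI[where C = 0])
  then show ?case
    by (intro exI[of _ 0] exI[of _ "\<lambda>_ _. 0"]) simp
next
  case (insert S \<T>)
  let ?B = "bounded_operators sc"
  let ?\<phi> = "\<lambda>T D. operator_trace sc ip (D \<circ> T)"
  let ?Q = "\<lambda>N D x. D (cut_off e N x)"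
  obtain M R where R: "\<And>D. D \<in> ?B \<Longrightarrow> R D \<in> vanishing_from e M"
    and R_eq: "\<And>D T. D \<in> ?B \<Longrightarrow> T \<in> \<T> \<Longrightarrow> ?\<phi> T (R D) = ?\<phi> T D"
    and R_lim: "\<And>D T. D \<in> ?B \<Longrightarrow> nuclear sc ip T \<Longrightarrow> (\<lambda>N. ?\<phi> T (R (?Q N D))) \<longlonglongrightarrow> ?\<phi> T (R D)"
    using insert.IH insert.prems by (metis insertCI)
  have S: "nuclear sc ip S" and nT: "\<And>T. T \<in> \<T> \<Longrightarrow> nuclear sc ip T"
    using insert.prems by auto
  have RB: "R D \<in> ?B" if "D \<in> ?B" for D
    using R[OF that] by (simp add: vanishing_from_def)
  have QB: "?Q N D \<in> ?B" if "D \<in> ?B" for N D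
    by (rule bounded_operators_compose[OF that cut_off_bounded_operator])
  \<comment> \<open>The error that the current interpolation \<open>R\<close> makes in the trace
    against the new operator \<open>S\<close>.\<close>
  define \<psi> where "\<psi> D = ?\<phi> S D - ?\<phi> S (R D)" for D
  have \<psi>_lim: "(\<lambda>N. \<psi> (?Q N D)) \<longlonglongrightarrow> \<psi> D" if "D \<in> ?B" for D
    unfolding \<psi>_def
    by (intro tendsto_diff R_lim that S
        tendsto_operator_trace[OF S that cut_off_bounded_operator norm_cut_off cut_off_tendsto])
  show ?case
  proof (cases "\<forall>D\<in>?B. \<psi> D = 0")
    case True
    have "?\<phi> S (R D) = ?\<phi> S D" if "D \<in> ?B" for D
      using True that by (simp add: \<psi>_def)
    then show ?thesis
      using R R_eq R_lim by (intro exI[of _ M] exI[of _ R]) blast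
  next
    case False
    then obtain D where D: "D \<in> ?B" "\<psi> D \<noteq> 0"
      by blast
    then have "\<forall>\<^sub>F N in sequentially. \<psi> (?Q N D) \<noteq> 0"
      using tendsto_imp_eventually_ne[OF \<psi>_lim] by blast
    then obtain N where N: "\<psi> (?Q N D) \<noteq> 0"
      unfolding eventually_sequentially by blast
    define E where "E = ?Q N D"
    \<comment> \<open>Since \<open>R\<close> already matches the traces on \<open>\<T>\<close>, the
      difference \<open>G\<close> of \<open>E\<close> and \<open>R E\<close> has trace zero against
      every member of \<open>\<T>\<close>, while against \<open>S\<close> it has trace
      \<open>\<psi> E \<noteq> 0\<close>. A multiple of \<open>G\<close> thus repairs the trace
      against \<open>S\<close> alone.\<close>
    define G where "G x = E x + sc (- 1) (R E x)" for x
    have E: "E \<in> ?B" "\<psi> E \<noteq> 0"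
      using QB[OF D(1)] N by (simp_all add: E_def)
    have GB: "G \<in> ?B"
      unfolding G_def by (intro bounded_operators_plus bounded_operators_scale RB E)
    have \<phi>G: "?\<phi> T G = ?\<phi> T E - ?\<phi> T (R E)" if "nuclear sc ip T" for T
      using operator_trace_plus[OF that E(1) bounded_operators_scale[OF RB[OF E(1)]], of "- 1"]
        operator_trace_scale[OF that RB[OF E(1)], of "- 1"]
      unfolding G_def by simp
    have "E (e k) = 0" if "k \<ge> N" for k
      using that real_vector.linear_0[OF bounded_linear.linear[OF bounded_operator_bounded_linear[OF D(1)]]]
      by (simp add: E_def cut_off_basis)
    then have G0: "G (e k) = 0" if "k \<ge> max M N" for k
      using that R[OF E(1)] by (simp add: G_def vanishing_from_def)
    define R' where "R' D = (\<lambda>x. R D x + sc (\<psi> D / \<psi> E) (G x))" for D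
    have "R' D \<in> vanishing_from e (max M N)" if "D \<in> ?B" for D
    proof -
      have "R' D \<in> ?B"
        unfolding R'_def by (intro bounded_operators_plus bounded_operators_scale RB GB that)
      moreover have "R' D (e k) = 0" if "k \<ge> max M N" for k
        using that G0 R[OF \<open>D \<in> ?B\<close>] by (simp add: R'_def vanishing_from_def)
      ultimately show ?thesis
        by (simp add: vanishing_from_def)
    qed
    moreover have \<phi>R': "?\<phi> T (R' D) = ?\<phi> T (R D) + \<psi> D / \<psi> E * ?\<phi> T G"
      if "D \<in> ?B" "nuclear sc ip T" for D T
      unfolding R'_def
      by (simp add: operator_trace_plus operator_trace_scale bounded_operators_scale RB GB that)
    have "?\<phi> T (R' D) = ?\<phi> T D" if "D \<in> ?B" "T \<in> insert S \<T>" for D T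
    proof (cases "T = S")
      case True
      then show ?thesis
        using E(2) \<phi>R'[OF that(1) S] \<phi>G[OF S] by (simp add: \<psi>_def)
    next
      case False
      then have T: "T \<in> \<T>" "nuclear sc ip T"
        using that nT by auto
      then show ?thesis
        using \<phi>R'[OF that(1) T(2)] \<phi>G[OF T(2)] by (simp add: R_eq that(1) E)
    qed
    \<comment> \<open>The coefficient \<open>\<psi> D / \<psi> E\<close> converges along the
      cut-offs because \<open>\<psi>\<close> does, so \<open>R'\<close> inherits the convergence
      clause.\<close>
    moreover have "(\<lambda>N. ?\<phi> T (R' (?Q N D))) \<longlonglongrightarrow> ?\<phi> T (R' D)"
      if "D \<in> ?B" "nuclear sc ip T" for D T
      unfolding \<phi>R'[OF that] \<phi>R'[OF QB[OF that(1)] that(2)]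
      by (intro tendsto_intros R_lim \<psi>_lim that E)
    ultimately show ?thesis
      by (intro exI[of _ "max M N"] exI[of _ R']) blast
  qed
qed

end

section \<open>Open sets of the ultraweak topology\<close>

lemma topspace_ultraweak: "topspace (ultraweak_topology sc ip) = bounded_operators sc"
  unfolding ultraweak_topology_def topology_generated_by_topspace
proof (intro equalityI subsetI)
  fix D
  assume "D \<in> bounded_operators sc"
  then have "D \<in> {D \<in> bounded_operators sc. operator_trace sc ip (D \<circ> (\<lambda>_. 0)) \<in> UNIV}"
    by simp
  then show "D \<in> \<Union>{{D \<in> bounded_operators sc. operator_trace sc ip (D \<circ> T) \<in> U} | T U. nuclear sc ip T \<and> open U}"
    using nuclear_zero open_UNIV by blast
qed blast

text \<open>A subbasic set around \<open>D\<close> contains every bounded operator with the same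
  trace against its \<open>T\<close>; intersections unite the finite families, and a union uses the
  family of one member. Exact agreement is the right condition because
  \<open>trace_interpolation\<close> reproduces traces exactly.\<close>

lemma ultraweak_open_contains_trace_fiber:
  assumes "openin (ultraweak_topology sc ip) U" "D \<in> U"
  shows "\<exists>\<T>. finite \<T> \<and> (\<forall>T\<in>\<T>. nuclear sc ip T) \<and>
    (\<forall>E\<in>bounded_operators sc. (\<forall>T\<in>\<T>. operator_trace sc ip (E \<circ> T) = operator_trace sc ip (D \<circ> T)) \<longrightarrow> E \<in> U)"
  using openin_topology_generated_by[OF assms(1)[unfolded ultraweak_topology_def]] assms(2)
proof (induction arbitrary: D rule: generate_topology_on.induct)
  case (Int U V)
  have D: "D \<in> U" "D \<in> V"
    using Int.prems by blast+
  from Int.IH(1)[OF D(1)] obtain \<T> where \<T>: "finite \<T>" "\<forall>T\<in>\<T>. nuclear sc ip T"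
    "\<forall>E\<in>bounded_operators sc. (\<forall>T\<in>\<T>. operator_trace sc ip (E \<circ> T) = operator_trace sc ip (D \<circ> T)) \<longrightarrow> E \<in> U"
    by (elim exE conjE)
  from Int.IH(2)[OF D(2)] obtain \<T>' where \<T>': "finite \<T>'" "\<forall>T\<in>\<T>'. nuclear sc ip T"
    "\<forall>E\<in>bounded_operators sc. (\<forall>T\<in>\<T>'. operator_trace sc ip (E \<circ> T) = operator_trace sc ip (D \<circ> T)) \<longrightarrow> E \<in> V"
    by (elim exE conjE)
  show ?case
  proof (intro exI[of _ "\<T> \<union> \<T>'"] conjI ballI impI IntI)
    show "finite (\<T> \<union> \<T>')"
      using \<T>(1) \<T>'(1) by simp
    show "nuclear sc ip T" if "T \<in> \<T> \<union> \<T>'" for T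
      using that \<T>(2) \<T>'(2) by blast
    fix E
    assume E: "E \<in> bounded_operators sc"
      and tr: "\<forall>T\<in>\<T> \<union> \<T>'. operator_trace sc ip (E \<circ> T) = operator_trace sc ip (D \<circ> T)"
    show "E \<in> U"
      by (rule \<T>(3)[THEN bspec, OF E, THEN mp]) (rule tr[unfolded ball_Un, THEN conjunct1])
    show "E \<in> V"
      by (rule \<T>'(3)[THEN bspec, OF E, THEN mp]) (rule tr[unfolded ball_Un, THEN conjunct2])
  qed
next
  case (UN K)
  then obtain k where "k \<in> K" "D \<in> k"
    by blast
  from UN.IH[OF this] obtain \<T> where \<T>: "finite \<T>" "\<forall>T\<in>\<T>. nuclear sc ip T"
    "\<forall>E\<in>bounded_operators sc. (\<forall>T\<in>\<T>. operator_trace sc ip (E \<circ> T) = operator_trace sc ip (D \<circ> T)) \<longrightarrow> E \<in> k"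
    by (elim exE conjE)
  show ?case
    by (intro exI[of _ \<T>] conjI ballI impI UnionI[OF \<open>k \<in> K\<close>] \<T>(1) \<T>(2)[THEN bspec] \<T>(3)[THEN bspec, THEN mp])
      (assumption | erule (1) bspec)+
next
  case (Basis s)
  then obtain T U where s: "s = {D \<in> bounded_operators sc. operator_trace sc ip (D \<circ> T) \<in> U}" "nuclear sc ip T"
    by blast
  have "operator_trace sc ip (D \<circ> T) \<in> U"
    using Basis.prems by (simp only: s(1) mem_Collect_eq)
  then show ?case
    unfolding s(1) using s(2) by (intro exI[of _ "{T}"] conjI ballI impI) (simp_all only: finite.intros singleton_iff mem_Collect_eq simp_thms ball_simps)
qed simp

end

section \<open>Singular value decomposition of a compact operator\<close>

context hilbert_space
begin

lemma norm_add_of_real_ip: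
  assumes "ip x y = of_real r"
  shows "(norm (x + y))\<^sup>2 = (norm x)\<^sup>2 + (norm y)\<^sup>2 + 2 * r"
proof -
  have "ip y x = of_real r"
    using ip_commute[of y x] assms by simp
  then have "ip (x + y) (x + y) = ip x x + ip y y + 2 * of_real r"
    using assms by (simp add: ip_add_left ip_add_right)
  then have "(of_real ((norm (x + y))\<^sup>2) :: 'k) = of_real ((norm x)\<^sup>2 + (norm y)\<^sup>2 + 2 * r)"
    by (simp only: ip_self of_real_add of_real_mult of_real_numeral)
  then show ?thesis
    by (simp only: of_real_eq_iff)
qed

text \<open>The image of the unit ball of square-summable sequences under the diagonal operator with
  entries \<open>s n\<close>. The coefficients \<open>a\<close> are relative to the half-lengths, so
  no division by \<open>s n\<close> occurs.\<close>

definition axis_ellipsoid :: "(nat \<Rightarrow> 'a) \<Rightarrow> (nat \<Rightarrow> real) \<Rightarrow> 'a set" where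
  "axis_ellipsoid e s = {x. \<exists>a. summable (\<lambda>n. (norm (a n))\<^sup>2) \<and> (\<Sum>n. (norm (a n))\<^sup>2) \<le> 1 \<and>
     (\<lambda>n. sc (a n * of_real (s n)) (e n)) sums x}"

end

locale compact_map = dom: hilbert_space sc' ip' + cod: hilbert_space sc ip
  for sc' :: "'k::hilbert_scalar \<Rightarrow> 'b::banach \<Rightarrow> 'b" and ip'
    and sc :: "'k \<Rightarrow> 'a::banach \<Rightarrow> 'a" and ip +
  fixes A :: "'b \<Rightarrow> 'a"
  assumes compact: "compact_operator sc' sc A"
    and infinite_rank: "\<not> finite_dimensional sc (range A)"
begin

lemma A_add: "A (x + y) = A x + A y" and A_scale: "A (sc' c x) = sc c (A x)"
  using compact unfolding compact_operator_def Vector_Spaces.linear_iff by blast+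

lemma compact_closure_image: "compact (closure (A ` cball 0 1))"
  using compact unfolding compact_operator_def by blast

lemma A_scaleR: "A (r *\<^sub>R x) = r *\<^sub>R A x"
  by (simp add: dom.scaleR_sc cod.scaleR_sc A_scale)

lemma bounded_linear_A: "bounded_linear A"
proof -
  have "bounded (A ` cball 0 1)"
    using compact_closure_image compact_imp_bounded bounded_subset closure_subset by blast
  then obtain B where B: "\<And>x. norm x \<le> 1 \<Longrightarrow> norm (A x) \<le> B"
    unfolding bounded_iff by (metis image_eqI mem_cball_0)
  have "norm (A x) \<le> norm x * B" for x
  proof (cases "x = 0")
    case True
    then show ?thesis
      using A_scaleR[of 0 0] by simp
  next
    case False
    then have "norm (A ((1 / norm x) *\<^sub>R x)) \<le> B"
      by (intro B) simp
    then show ?thesis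
      using False by (simp add: A_scaleR field_simps)
  qed
  then show ?thesis
    by (intro bounded_linear_intro[where K = B] A_add A_scaleR)
qed

sublocale A: bounded_linear A
  by (rule bounded_linear_A)

lemma convergent_subsequence:
  fixes g :: "nat \<Rightarrow> 'b"
  assumes "\<And>n. norm (g n) \<le> 1"
  shows "\<exists>l r. strict_mono (r :: nat \<Rightarrow> nat) \<and> (\<lambda>n. A (g (r n))) \<longlonglongrightarrow> l"
proof -
  have "\<forall>n. A (g n) \<in> closure (A ` cball 0 1)"
    using assms closure_subset by fastforce
  then obtain l r where "strict_mono r" "((\<lambda>n. A (g n)) \<circ> r) \<longlonglongrightarrow> l"
    using compact_imp_seq_compact[OF compact_closure_image] unfolding seq_compact_def by metis
  then show ?thesis
    unfolding o_def by blast
qed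

text \<open>
  With \<open>\<sigma>\<close> the supremum of \<open>(norm (A g))\<^sup>2\<close> over the unit ball of \<open>V\<close>, the quadratic form
  \<open>\<sigma> * (norm g)\<^sup>2 - (norm (A g))\<^sup>2\<close> is nonnegative on \<open>V\<close>. By its parallelogram law, a maximising
  sequence whose images converge is itself Cauchy.
\<close>

lemma exists_maximiser:
  assumes V: "dom.subspace V" "closed V" and ne: "g0 \<in> V" "A g0 \<noteq> 0"
  shows "\<exists>f\<in>V. norm f = 1 \<and> A f \<noteq> 0 \<and> (\<forall>g\<in>V. norm (A g) \<le> norm (A f) * norm g)"
proof -
  define U where "U = V \<inter> cball 0 1"
  define \<sigma> where "\<sigma> = (SUP g\<in>U. (norm (A g))\<^sup>2)"
  obtain B where B: "\<And>x. norm (A x) \<le> norm x * B" "B \<ge> 0"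
    using A.nonneg_bounded by blast
  have bdd: "bdd_above ((\<lambda>g. (norm (A g))\<^sup>2) ` U)"
  proof (rule bdd_aboveI2)
    fix g
    assume "g \<in> U"
    then have "norm g \<le> 1"
      by (simp add: U_def)
    then have "norm (A g) \<le> B"
      using B(1)[of g] mult_right_mono[of "norm g" 1 B] B(2) by simp
    then show "(norm (A g))\<^sup>2 \<le> B\<^sup>2"
      by (rule power_mono) simp
  qed
  have neU: "U \<noteq> {}"
    using dom.subspace_0[OF V(1)] by (auto simp: U_def)
  have scaled: "(1 / norm g) *\<^sub>R g \<in> U" if "g \<in> V" "g \<noteq> 0" for g
  proof -
    have "(1 / norm g) *\<^sub>R g \<in> V"
      unfolding dom.scaleR_sc by (rule dom.subspace_scale[OF V(1) that(1)])
    then show ?thesis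
      using that(2) by (simp add: U_def)
  qed
  have le: "(norm (A g))\<^sup>2 \<le> \<sigma> * (norm g)\<^sup>2" if "g \<in> V" for g
  proof (cases "g = 0")
    case False
    have "(norm (A ((1 / norm g) *\<^sub>R g)))\<^sup>2 \<le> \<sigma>"
      unfolding \<sigma>_def by (rule cSUP_upper[OF scaled[OF that False] bdd])
    then show ?thesis
      using False by (simp add: A_scaleR power_divide divide_le_eq)
  qed (simp add: A.zero)
  have "\<sigma> > 0"
  proof -
    have "0 < (norm (A g0))\<^sup>2"
      using ne(2) by simp
    also have "\<dots> \<le> \<sigma> * (norm g0)\<^sup>2"
      by (rule le[OF ne(1)])
    finally show ?thesis
      by (simp add: zero_less_mult_iff)
  qed
  have "\<exists>g\<in>U. \<sigma> - 1 / real (Suc n) < (norm (A g))\<^sup>2" for n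
    using less_cSUP_iff[OF neU bdd, of "\<sigma> - 1 / real (Suc n)"] by (simp add: \<sigma>_def)
  then obtain g where g: "\<And>n. g n \<in> U" "\<And>n. \<sigma> - 1 / real (Suc n) < (norm (A (g n)))\<^sup>2"
    by metis
  have g_lim: "(\<lambda>n. (norm (A (g n)))\<^sup>2) \<longlonglongrightarrow> \<sigma>"
  proof (rule tendsto_sandwich[OF _ _ _ tendsto_const])
    show "\<forall>\<^sub>F n in sequentially. \<sigma> - 1 / real (Suc n) \<le> (norm (A (g n)))\<^sup>2"
      using g(2) by (simp add: less_imp_le)
    show "\<forall>\<^sub>F n in sequentially. (norm (A (g n)))\<^sup>2 \<le> \<sigma>"
      unfolding \<sigma>_def using cSUP_upper[OF g(1) bdd] by simp
    show "(\<lambda>n. \<sigma> - 1 / real (Suc n)) \<longlonglongrightarrow> \<sigma>"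
      using tendsto_diff[OF tendsto_const lim_1_over_n[THEN LIMSEQ_Suc], of \<sigma>] by simp
  qed
  obtain l r where r: "strict_mono (r :: nat \<Rightarrow> nat)" "(\<lambda>n. A (g (r n))) \<longlonglongrightarrow> l"
    using convergent_subsequence[of g] g(1) unfolding U_def by auto
  define h where "h n = g (r n)" for n
  have h: "h n \<in> V" "norm (h n) \<le> 1" for n
    using g(1)[of "r n"] by (simp_all add: h_def U_def)
  have h_lim: "(\<lambda>n. (norm (A (h n)))\<^sup>2) \<longlonglongrightarrow> \<sigma>"
    using LIMSEQ_subseq_LIMSEQ[OF g_lim r(1)] by (simp add: h_def o_def)
  have "Cauchy (\<lambda>n. A (h n))"
    using r(2) by (simp add: h_def LIMSEQ_imp_Cauchy)
  have "Cauchy h"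
  proof (rule metric_CauchyI)
    fix \<epsilon> :: real
    assume "\<epsilon> > 0"
    \<comment> \<open>With these tolerances the two defects contribute at most
      \<open>\<sigma> * \<epsilon>^2 / 2\<close> to \<open>\<sigma> * (norm (h m - h n))^2\<close>,
      and the difference of the images at most \<open>\<sigma> * \<epsilon>^2 / 4\<close>.\<close>
    have "\<forall>\<^sub>F n in sequentially. (norm (A (h n)))\<^sup>2 > \<sigma> - \<sigma> * \<epsilon>\<^sup>2 / 8"
      using \<open>\<epsilon> > 0\<close> \<open>\<sigma> > 0\<close> by (intro order_tendstoD[OF h_lim]) simp
    then obtain N where N: "\<And>n. n \<ge> N \<Longrightarrow> (norm (A (h n)))\<^sup>2 > \<sigma> - \<sigma> * \<epsilon>\<^sup>2 / 8"
      unfolding eventually_sequentially by blast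
    have "sqrt \<sigma> * \<epsilon> / 2 > 0"
      using \<open>\<epsilon> > 0\<close> \<open>\<sigma> > 0\<close> by simp
    from metric_CauchyD[OF \<open>Cauchy (\<lambda>n. A (h n))\<close> this] obtain N'
      where N': "\<And>m n. m \<ge> N' \<Longrightarrow> n \<ge> N' \<Longrightarrow> norm (A (h m) - A (h n)) < sqrt \<sigma> * \<epsilon> / 2"
      unfolding dist_norm by blast
    have "dist (h m) (h n) < \<epsilon>" if "m \<ge> max N N'" "n \<ge> max N N'" for m n
    proof -
      have "(norm (A (h m) - A (h n)))\<^sup>2 < (sqrt \<sigma> * \<epsilon> / 2)\<^sup>2"
        using N'[of m n] that by (intro power_strict_mono) auto
      also have "(sqrt \<sigma> * \<epsilon> / 2)\<^sup>2 = \<sigma> * \<epsilon>\<^sup>2 / 4"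
        using \<open>\<sigma> > 0\<close> by (simp add: power_mult_distrib power_divide)
      finally have 1: "(norm (A (h m) - A (h n)))\<^sup>2 < \<sigma> * \<epsilon>\<^sup>2 / 4" .
      have 2: "\<sigma> * (norm (h k))\<^sup>2 \<le> \<sigma>" for k
        using h(2)[of k] \<open>\<sigma> > 0\<close> by (simp add: mult_left_le power_le_one)
      have 3: "(norm (A (h m) + A (h n)))\<^sup>2 \<le> \<sigma> * (norm (h m + h n))\<^sup>2"
        using le[OF dom.subspace_add[OF V(1) h(1) h(1)], of m n] by (simp add: A_add)
      have "\<sigma> * (norm (h m + h n))\<^sup>2 + \<sigma> * (norm (h m - h n))\<^sup>2 = 2 * (\<sigma> * (norm (h m))\<^sup>2) + 2 * (\<sigma> * (norm (h n))\<^sup>2)"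
        using arg_cong[OF dom.parallelogram[of "h m" "h n"], of "\<lambda>t. \<sigma> * t"]
        by (simp only: distrib_left mult.left_commute)
      moreover have "(norm (A (h m)))\<^sup>2 > \<sigma> - \<sigma> * \<epsilon>\<^sup>2 / 8" "(norm (A (h n)))\<^sup>2 > \<sigma> - \<sigma> * \<epsilon>\<^sup>2 / 8"
        using N that by auto
      moreover have "\<sigma> * \<epsilon>\<^sup>2 > 0"
        using \<open>\<sigma> > 0\<close> \<open>\<epsilon> > 0\<close> by simp
      ultimately have "\<sigma> * (norm (h m - h n))\<^sup>2 < \<sigma> * \<epsilon>\<^sup>2"
        using cod.parallelogram[of "A (h m)" "A (h n)"] 1 2[of m] 2[of n] 3 by linarith
      then have "norm (h m - h n) < \<epsilon>"
        using \<open>\<sigma> > 0\<close> \<open>\<epsilon> > 0\<close> by (simp add: power_less_imp_less_base)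
      then show ?thesis
        by (simp add: dist_norm)
    qed
    then show "\<exists>N. \<forall>m\<ge>N. \<forall>n\<ge>N. dist (h m) (h n) < \<epsilon>"
      by blast
  qed
  then obtain f where f: "h \<longlonglongrightarrow> f"
    using Cauchy_convergent_iff convergent_def by blast
  have "f \<in> V"
    using closed_sequentially[OF V(2) _ f] h(1) by blast
  have "norm f \<le> 1"
    by (rule LIMSEQ_le_const2[OF tendsto_norm[OF f]]) (use h(2) in blast)
  have Af: "(norm (A f))\<^sup>2 = \<sigma>"
    by (rule LIMSEQ_unique[OF _ h_lim]) (intro tendsto_intros A.tendsto f)
  \<comment> \<open>The supremum is attained in the ball; by homogeneity and
    \<open>\<sigma> > 0\<close> it can only be attained on the sphere.\<close>
  have "\<sigma> * 1 \<le> \<sigma> * (norm f)\<^sup>2"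
    using le[OF \<open>f \<in> V\<close>] Af by simp
  then have "1 \<le> (norm f)\<^sup>2"
    using \<open>\<sigma> > 0\<close> by (simp only: mult_le_cancel_left_pos)
  then have "norm f = 1"
    using \<open>norm f \<le> 1\<close> by (metis norm_ge_zero order_antisym power2_le_imp_le one_power2)
  moreover have "A f \<noteq> 0"
    using Af \<open>\<sigma> > 0\<close> by auto
  moreover have "norm (A g) \<le> norm (A f) * norm g" if "g \<in> V" for g
    by (rule power2_le_imp_le) (use le[OF that] in \<open>simp_all add: power_mult_distrib Af\<close>)
  ultimately show ?thesis
    using \<open>f \<in> V\<close> by blast
qed

text \<open>A first variation argument. Moving from \<open>f\<close> by a small multiple of
  \<open>g\<close>, with the phase of \<open>ip (A f) (A g)\<close>, raises the squared norm of the
  image to first order, while orthogonality to \<open>f\<close> lets the squared norm of the vector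
  grow only to second order.\<close>

lemma maximiser_orthogonal:
  assumes V: "dom.subspace V" and f: "f \<in> V" "norm f = 1"
    and max: "\<And>g. g \<in> V \<Longrightarrow> norm (A g) \<le> norm (A f) * norm g"
    and g: "g \<in> V" "ip' f g = 0"
  shows "ip (A f) (A g) = 0"
proof (rule ccontr)
  define w where "w = ip (A f) (A g)"
  assume "ip (A f) (A g) \<noteq> 0"
  then have "norm w > 0"
    by (simp add: w_def)
  define X where "X = (norm (A f))\<^sup>2 * (norm g)\<^sup>2 - (norm (A g))\<^sup>2"
  \<comment> \<open>Maximality at step length \<open>s\<close> will force
    \<open>2 \<le> s * X\<close>, where \<open>X\<close> collects the second-order terms; this
    \<open>s\<close> keeps \<open>s * X\<close> at most 1.\<close>
  define s where "s = 1 / (\<bar>X\<bar> + 1)"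
  have "s > 0"
    by (simp add: s_def add_nonneg_pos)
  define c where "c = of_real s * w"
  have nc: "norm c = s * norm w"
    using \<open>s > 0\<close> by (simp add: c_def norm_mult)
  have "ip (A f) (sc c (A g)) = of_real (s * (norm w)\<^sup>2)"
    by (simp add: cod.ip_scale_right c_def scnj_mult scnj_mult_self mult.assoc flip: w_def)
  from cod.norm_add_of_real_ip[OF this]
  have 1: "(norm (A (f + sc' c g)))\<^sup>2 = (norm (A f))\<^sup>2 + (s * norm w * norm (A g))\<^sup>2 + 2 * (s * (norm w)\<^sup>2)"
    by (simp add: A_add A_scale cod.norm_sc nc)
  have "(norm (f + sc' c g))\<^sup>2 = 1 + (s * norm w * norm g)\<^sup>2"
    using dom.pythagoras[of f "sc' c g"] f(2) g(2) by (simp add: dom.ip_scale_right dom.norm_sc nc)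
  moreover have "norm (A (f + sc' c g)) \<le> norm (A f) * norm (f + sc' c g)"
    by (intro max dom.subspace_add dom.subspace_scale V f g)
  then have "(norm (A (f + sc' c g)))\<^sup>2 \<le> (norm (A f) * norm (f + sc' c g))\<^sup>2"
    by (rule power_mono) simp
  ultimately have "(s * norm w * norm (A g))\<^sup>2 + 2 * (s * (norm w)\<^sup>2) \<le> (norm (A f))\<^sup>2 * (s * norm w * norm g)\<^sup>2"
    unfolding 1 by (simp add: power_mult_distrib algebra_simps)
  then have "(s * (norm w)\<^sup>2) * 2 \<le> (s * (norm w)\<^sup>2) * (s * X)"
    unfolding X_def by (simp add: power2_eq_square algebra_simps)
  then have "2 \<le> s * X"
    using \<open>s > 0\<close> \<open>norm w > 0\<close> by (subst (asm) mult_le_cancel_left_pos) auto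
  moreover have "s * X \<le> 1"
    by (simp add: s_def field_simps)
  ultimately show False
    by simp
qed

section \<open>Singular vectors\<close>

definition orthocomplement :: "(nat \<Rightarrow> 'b) \<Rightarrow> nat \<Rightarrow> 'b set" where
  "orthocomplement f n = {g. \<forall>i<n. ip' g (f i) = 0}"

lemma subspace_orthocomplement: "dom.subspace (orthocomplement f n)"
  by (rule dom.subspaceI) (simp_all add: orthocomplement_def dom.ip_add_left dom.ip_scale_left)

lemma closed_orthocomplement: "closed (orthocomplement f n)"
proof -
  have "orthocomplement f n = (\<Inter>i<n. {g. ip' g (f i) = 0})"
    by (auto simp: orthocomplement_def)
  moreover have "closed {g. ip' g (f i) = 0}" for i
    by (intro closed_Collect_eq dom.ip.continuous_on continuous_intros)
  ultimately show ?thesis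
    by auto
qed

text \<open>The vectors are chosen greedily, each a maximiser on the complement of its predecessors.
  The choice never stops: if \<open>A\<close> vanished on the complement of \<open>n\<close> of
  them, its range would be spanned by their \<open>n\<close> images.\<close>

lemma exists_singular_vectors:
  "\<exists>f. dom.orthonormal f UNIV \<and> (\<forall>n. A (f n) \<noteq> 0) \<and>
     (\<forall>n. \<forall>g\<in>orthocomplement f n. norm (A g) \<le> norm (A (f n)) * norm g)"
proof -
  define P where "P f n r \<longleftrightarrow> r \<in> orthocomplement f n \<and> norm r = 1 \<and> A r \<noteq> 0 \<and>
    (\<forall>g\<in>orthocomplement f n. norm (A g) \<le> norm (A r) * norm g)" for f n r
  have ON: "dom.orthonormal f {..<n}" if f: "\<And>i. i < n \<Longrightarrow> P f i (f i)" for f n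
  proof -
    have "ip' (f i) (f j) = 0" if "j < i" "i < n" for i j
      using f[OF that(2)] that(1) unfolding P_def orthocomplement_def by blast
    then have "ip' (f i) (f j) = 0" if "i \<noteq> j" "i < n" "j < n" for i j
      using that dom.ip_eq_0_commute by (metis linorder_neqE_nat)
    moreover have "ip' (f i) (f i) = 1" if "i < n" for i
      using f[OF that] unfolding P_def by (simp add: dom.ip_self)
    ultimately show ?thesis
      unfolding dom.orthonormal_def by auto
  qed
  \<comment> \<open>\<open>P f n\<close> looks at \<open>f\<close> only below \<open>n\<close>,
    which makes the recursive choice legitimate.\<close>
  have "\<exists>f. \<forall>n. P f n (f n)"
  proof (rule dependent_wellorder_choice)
    show "P f n r = P f' n r" if "\<And>m. m < n \<Longrightarrow> f m = f' m" for f f' and n :: nat and r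
      using that by (simp add: P_def orthocomplement_def)
    fix n and f :: "nat \<Rightarrow> 'b"
    assume "\<And>m. m < n \<Longrightarrow> P f m (f m)"
    then have f: "dom.orthonormal f {..<n}"
      by (rule ON)
    have "\<exists>g\<in>orthocomplement f n. A g \<noteq> 0"
    proof (rule ccontr)
      assume *: "\<not> (\<exists>g\<in>orthocomplement f n. A g \<noteq> 0)"
      have "A x \<in> cod.span ((\<lambda>i. A (f i)) ` {..<n})" for x
      proof -
        have "x - (\<Sum>i<n. sc' (ip' x (f i)) (f i)) \<in> orthocomplement f n"
          using dom.orthonormal_residual[OF f] by (simp add: orthocomplement_def)
        then have "A x = A (\<Sum>i<n. sc' (ip' x (f i)) (f i))"
          using * A.diff by (metis eq_iff_diff_eq_0)
        also have "\<dots> = (\<Sum>i<n. sc (ip' x (f i)) (A (f i)))"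
          by (simp add: A.sum A_scale)
        also have "\<dots> \<in> cod.span ((\<lambda>i. A (f i)) ` {..<n})"
          by (intro cod.span_sum cod.span_scale cod.span_base) auto
        finally show ?thesis .
      qed
      then have "finite_dimensional sc (range A)"
        unfolding finite_dimensional_def by (intro exI[of _ "(\<lambda>i. A (f i)) ` {..<n}"]) auto
      then show False
        using infinite_rank by blast
    qed
    then show "\<exists>r. P f n r"
      using exists_maximiser[OF subspace_orthocomplement closed_orthocomplement] unfolding P_def by blast
  qed
  then obtain f where f: "\<And>n. P f n (f n)"
    by blast
  have "dom.orthonormal f UNIV"
    unfolding dom.orthonormal_def
  proof (intro ballI)
    fix i j :: nat
    show "ip' (f i) (f j) = (if i = j then 1 else 0)"
      using dom.orthonormalD[OF ON[of "Suc (max i j)"], of f i j] f by simp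
  qed
  then show ?thesis
    using f unfolding P_def by blast
qed

text \<open>The half-lengths are the norms of the vectors \<open>A (f n)\<close> and the axes their
  directions. The expansion of \<open>A x\<close> turns the unit ball into square-summable
  coefficients by Bessel's inequality; conversely, such coefficients are those of a vector in the
  ball.\<close>

lemma image_axis_ellipsoid:
  "\<exists>e s. cod.orthonormal e UNIV \<and> (\<forall>n. s n > 0) \<and> decseq s \<and> A ` cball 0 1 = cod.axis_ellipsoid e s"
proof -
  obtain f where f: "dom.orthonormal f UNIV" and Af: "\<forall>n. A (f n) \<noteq> 0"
    and max': "\<forall>n. \<forall>g\<in>orthocomplement f n. norm (A g) \<le> norm (A (f n)) * norm g"
    using exists_singular_vectors by (elim exE conjE)
  have max: "norm (A g) \<le> norm (A (f n)) * norm g" if "g \<in> orthocomplement f n" for n g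
    using max' that by blast
  define s where "s n = norm (A (f n))" for n
  define e where "e n = (1 / s n) *\<^sub>R A (f n)" for n
  have s: "s n > 0" for n
    using Af by (simp add: s_def)
  have fn: "norm (f n) = 1" for n
    using dom.orthonormal_norm[OF f] by simp
  have f_mem: "f m \<in> orthocomplement f n" if "n \<le> m" for m n
    using that dom.orthonormalD[OF f] by (auto simp: orthocomplement_def)
  have orth: "ip (A (f m)) (A (f n)) = 0" if "m \<noteq> n" for m n
  proof -
    have *: "ip (A (f m)) (A (f n)) = 0" if "m < n" for m n
      by (rule maximiser_orthogonal[OF subspace_orthocomplement f_mem[OF order_refl] fn max])
         (use that f_mem dom.orthonormalD[OF f] in auto)
    show ?thesis
      using *[of m n] *[of n m] that cod.ip_eq_0_commute by (metis linorder_neqE_nat)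
  qed
  have "cod.orthonormal e UNIV"
    unfolding cod.orthonormal_def
  proof (intro ballI)
    fix i j :: nat
    have "ip (e i) (e i) = 1"
    proof -
      have "norm (e i) = 1"
        using s[of i] by (simp add: e_def s_def)
      then show ?thesis
        by (simp add: cod.ip_self)
    qed
    moreover have "ip (e i) (e j) = 0" if "i \<noteq> j"
      using orth[OF that] by (simp add: e_def cod.ip_scaleR_left cod.ip_scaleR_right)
    ultimately show "ip (e i) (e j) = (if i = j then 1 else 0)"
      by (cases "i = j") simp_all
  qed
  moreover have "decseq s"
  proof (rule decseq_SucI)
    show "s (Suc n) \<le> s n" for n
      using max[OF f_mem[of n "Suc n"]] fn by (simp add: s_def)
  qed
  \<comment> \<open>Otherwise the orthogonal vectors \<open>A (f n)\<close> would keep mutual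
    distance at least \<open>L\<close>, contrary to the convergent subsequence given by
    compactness.\<close>
  moreover have "s \<longlonglongrightarrow> 0"
  proof -
    obtain L where L: "s \<longlonglongrightarrow> L" "\<And>i. L \<le> s i"
      using decseq_convergent[OF \<open>decseq s\<close>, of 0] s by (metis less_imp_le)
    have "\<not> L > 0"
    proof
      assume "L > 0"
      obtain l r where r: "strict_mono (r :: nat \<Rightarrow> nat)" "(\<lambda>n. A (f (r n))) \<longlonglongrightarrow> l"
        using convergent_subsequence[of f] fn by auto
      from metric_CauchyD[OF LIMSEQ_imp_Cauchy[OF r(2)] \<open>L > 0\<close>] obtain N
        where N: "\<And>m n. m \<ge> N \<Longrightarrow> n \<ge> N \<Longrightarrow> norm (A (f (r m)) - A (f (r n))) < L"
        unfolding dist_norm by blast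
      have "r N \<noteq> r (Suc N)"
        using r(1) by (simp add: strict_mono_eq)
      then have "(norm (A (f (r N)) + - A (f (r (Suc N)))))\<^sup>2 = (s (r N))\<^sup>2 + (s (r (Suc N)))\<^sup>2"
        using cod.pythagoras[of "A (f (r N))" "- A (f (r (Suc N)))"] orth
        by (simp add: cod.ip_minus_right s_def)
      moreover have "L\<^sup>2 \<le> (s (r N))\<^sup>2"
        using power_mono[OF L(2)[of "r N"], of 2] \<open>L > 0\<close> by simp
      ultimately have "L\<^sup>2 \<le> (norm (A (f (r N)) - A (f (r (Suc N)))))\<^sup>2"
        by (simp add: add_increasing2)
      then have "L \<le> norm (A (f (r N)) - A (f (r (Suc N))))"
        by (rule power2_le_imp_le) simp
      then show False
        using N[of N "Suc N"] by simp
    qed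
    moreover have "L \<ge> 0"
      by (rule LIMSEQ_le_const[OF L(1)]) (use s in \<open>auto intro: less_imp_le\<close>)
    ultimately show ?thesis
      using L(1) by simp
  qed
  have expand: "(\<lambda>n. sc (ip' x (f n) * of_real (s n)) (e n)) sums A x" for x
  proof -
    have eq: "sc (ip' x (f n) * of_real (s n)) (e n) = sc (ip' x (f n)) (A (f n))" for n
      using s[of n] by (simp add: e_def cod.scaleR_sc flip: of_real_mult)
    \<comment> \<open>The remainder of \<open>x\<close> after \<open>n\<close> terms lies in
      \<open>orthocomplement f n\<close>, where \<open>A\<close> shrinks norms by
      \<open>s n\<close>. Thus the expansion holds although \<open>f\<close> need not be
      complete.\<close>
    have "(\<lambda>n. A x - (\<Sum>i<n. sc (ip' x (f i)) (A (f i)))) \<longlonglongrightarrow> 0"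
    proof (rule Lim_null_comparison)
      show "\<forall>\<^sub>F n in sequentially. norm (A x - (\<Sum>i<n. sc (ip' x (f i)) (A (f i)))) \<le> s n * norm x"
      proof (rule always_eventually, rule allI)
        fix n
        have fn: "dom.orthonormal f {..<n}"
          by (rule dom.orthonormal_mono[OF f]) simp
        let ?y = "x - (\<Sum>i<n. sc' (ip' x (f i)) (f i))"
        have "?y \<in> orthocomplement f n"
          using dom.orthonormal_residual[OF fn] by (simp add: orthocomplement_def)
        then have "norm (A ?y) \<le> s n * norm ?y"
          unfolding s_def by (rule max)
        also have "norm ?y \<le> norm x"
          using dom.norm_residual_mono[OF fn, of "{}" x] by simp
        finally show "norm (A x - (\<Sum>i<n. sc (ip' x (f i)) (A (f i)))) \<le> s n * norm x"
          using s[of n] by (simp add: A.diff A.sum A_scale)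
      qed
      show "(\<lambda>n. s n * norm x) \<longlonglongrightarrow> 0"
        using tendsto_mult_left_zero[OF \<open>s \<longlonglongrightarrow> 0\<close>] .
    qed
    from tendsto_diff[OF tendsto_const this, of "A x"] show ?thesis
      by (simp add: sums_def eq)
  qed
  have "A ` cball 0 1 = cod.axis_ellipsoid e s"
  proof (intro equalityI subsetI)
    fix y
    assume "y \<in> A ` cball 0 1"
    then obtain x where x: "y = A x" "norm x \<le> 1"
      by auto
    have "(\<Sum>n. (norm (ip' x (f n)))\<^sup>2) \<le> (norm x)\<^sup>2"
      by (rule dom.suminf_Bessel[OF f])
    also have "\<dots> \<le> 1"
      using x(2) by (simp add: power_le_one)
    finally have "(\<Sum>n. (norm (ip' x (f n)))\<^sup>2) \<le> 1" .
    then show "y \<in> cod.axis_ellipsoid e s"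
      unfolding cod.axis_ellipsoid_def x(1)
      by (intro CollectI exI[of _ "\<lambda>n. ip' x (f n)"] conjI dom.summable_Bessel[OF f] expand)
  next
    fix y
    assume "y \<in> cod.axis_ellipsoid e s"
    then obtain a where a: "summable (\<lambda>n. (norm (a n))\<^sup>2)" "(\<Sum>n. (norm (a n))\<^sup>2) \<le> 1"
      and y: "(\<lambda>n. sc (a n * of_real (s n)) (e n)) sums y"
      unfolding cod.axis_ellipsoid_def by blast
    obtain x where x: "(\<lambda>n. sc' (a n) (f n)) sums x"
      using dom.summable_orthonormal[OF f a(1)] summable_def by blast
    have "(norm x)\<^sup>2 \<le> 1"
      using sums_unique[OF dom.norm_orthonormal_sums[OF f x]] a(2) by simp
    then have "norm x \<le> 1"
      by (simp add: power2_le_imp_le abs_square_le_1)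
    moreover have "y = A x"
      using expand[of x] y unfolding dom.ip_orthonormal_sums[OF f x] by (rule sums_unique2[symmetric])
    ultimately show "y \<in> A ` cball 0 1"
      by auto
  qed
  ultimately show ?thesis
    using s by blast
qed

end

section \<open>Ellipsoids and their widths\<close>

text \<open>Gaussian elimination: an unknown \<open>i0\<close> with nonzero coefficient in equation
  \<open>b\<close> is eliminated from the others and recovered at the end from \<open>b\<close>. The
  count is used for \<open>n\<close> orthogonality conditions on \<open>n + 1\<close> axes.\<close>

lemma homogeneous_system_nontrivial_solution:
  fixes f :: "'j \<Rightarrow> 'i \<Rightarrow> 'k::field"
  assumes "finite B" "finite I" "card B < card I"
  shows "\<exists>a. (\<exists>i\<in>I. a i \<noteq> 0) \<and> (\<forall>b\<in>B. (\<Sum>i\<in>I. a i * f b i) = 0)"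
  using assms
proof (induction B arbitrary: I f rule: finite_induct)
  case empty
  then show ?case
    by (intro exI[of _ "\<lambda>_. 1"]) (auto simp: card_gt_0_iff)
next
  case (insert b B)
  show ?case
  proof (cases "\<forall>i\<in>I. f b i = 0")
    case True
    moreover have "card B < card I"
      using insert.hyps insert.prems by simp
    ultimately show ?thesis
      using insert.IH[OF insert.prems(1), of f] by auto
  next
    case False
    then obtain i0 where i0: "i0 \<in> I" "f b i0 \<noteq> 0"
      by blast
    define J where "J = I - {i0}"
    have J: "finite J" "i0 \<notin> J" "I = insert i0 J"
      using i0 insert.prems by (auto simp: J_def)
    have "card B < card J"
      using insert.hyps insert.prems J by simp
    from insert.IH[OF J(1) this, of "\<lambda>b' i. f b' i - f b i * (f b' i0 / f b i0)"]
    obtain a where a: "\<exists>i\<in>J. a i \<noteq> 0"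
      and a0: "\<And>b'. b' \<in> B \<Longrightarrow> (\<Sum>i\<in>J. a i * (f b' i - f b i * (f b' i0 / f b i0))) = 0"
      by blast
    define a' where "a' = a(i0 := - (\<Sum>i\<in>J. a i * f b i) / f b i0)"
    have sum_a': "(\<Sum>i\<in>I. a' i * f b' i) = (\<Sum>i\<in>J. a i * f b' i) - (\<Sum>i\<in>J. a i * f b i) * (f b' i0 / f b i0)" for b'
    proof -
      have "(\<Sum>i\<in>J. a' i * f b' i) = (\<Sum>i\<in>J. a i * f b' i)"
        using J(2) by (intro sum.cong) (auto simp: a'_def)
      then show ?thesis
        unfolding J(3) using J(1,2) by (simp add: a'_def)
    qed
    have "(\<Sum>i\<in>I. a' i * f b' i) = 0" if "b' \<in> insert b B" for b'
    proof (cases "b' = b")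
      case True
      then show ?thesis
        unfolding sum_a' using i0(2) by simp
    next
      case False
      then have "(\<Sum>i\<in>J. a i * (f b' i - f b i * (f b' i0 / f b i0))) = 0"
        using that a0 by blast
      then show ?thesis
        unfolding sum_a' sum_distrib_right by (simp add: right_diff_distrib sum_subtractf mult.assoc)
    qed
    moreover have "\<exists>i\<in>I. a' i \<noteq> 0"
      using a J by (auto simp: a'_def)
    ultimately show ?thesis
      by blast
  qed
qed

text \<open>A positive lower limit bounds all late ratios from below, and the finitely many early
  ones are positive, so a minimum works. The bound must hold for every \<open>n\<close> because it
  will be iterated from any starting index.\<close>

lemma not_lacunary_ratio:
  assumes pos: "\<And>n. a n > 0" and "\<not> lacunary a"
  shows "\<exists>c>0. \<forall>n. c * a n \<le> a (Suc n)"
proof -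
  let ?r = "\<lambda>n. a (Suc n) / a n"
  have r: "?r n > 0" for n
    using pos by simp
  have "0 \<le> liminf (\<lambda>n. ereal (?r n))"
    by (rule Liminf_bounded) (use r in \<open>simp add: less_imp_le\<close>)
  then have "0 < liminf (\<lambda>n. ereal (?r n))"
    using assms(2) unfolding lacunary_def by (simp add: order_less_le)
  then obtain c where c: "0 < ereal c" "ereal c < liminf (\<lambda>n. ereal (?r n))"
    using ereal_dense2 by blast
  from less_LiminfD[OF c(2)] obtain N where N: "\<And>n. n \<ge> N \<Longrightarrow> c < ?r n"
    unfolding eventually_sequentially by auto
  define d where "d = Min (insert c (?r ` {..<N}))"
  have "d > 0"
    using c(1) r by (simp add: d_def)
  moreover have "d * a n \<le> a (Suc n)" for n
  proof -
    have "d \<le> ?r n"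
    proof (cases "n < N")
      case True
      then show ?thesis
        unfolding d_def by (intro Min_le) auto
    next
      case False
      have "d \<le> c"
        unfolding d_def by (intro Min_le) auto
      also have "c < ?r n"
        using N False by simp
      finally show ?thesis
        by simp
    qed
    then show ?thesis
      using pos[of n] by (simp add: pos_le_divide_eq)
  qed
  ultimately show ?thesis
    by blast
qed

context hilbert_space
begin

section \<open>Widths of an ellipsoid with orthonormal axes\<close>

context
  fixes e :: "nat \<Rightarrow> 'a" and s :: "nat \<Rightarrow> real"
  assumes e: "orthonormal e UNIV" and s: "\<And>n. s n > 0" and dec: "decseq s"
begin

text \<open>Beyond the first \<open>n\<close> axes the half-lengths are at most \<open>s n\<close>,
  and the coefficients \<open>a\<close> have square sum at most 1. This gives the upper bound for
  the width.\<close>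

lemma axis_ellipsoid_tail:
  assumes "x \<in> axis_ellipsoid e s"
  shows "norm (x - (\<Sum>i<n. sc (ip x (e i)) (e i))) \<le> s n"
proof -
  obtain a where a: "summable (\<lambda>n. (norm (a n))\<^sup>2)" "(\<Sum>n. (norm (a n))\<^sup>2) \<le> 1"
    and x: "(\<lambda>n. sc (a n * of_real (s n)) (e n)) sums x"
    using assms unfolding axis_ellipsoid_def by blast
  let ?c = "\<lambda>i. (norm (ip x (e i)))\<^sup>2"
  have c: "?c i = (norm (a i))\<^sup>2 * (s i)\<^sup>2" for i
    unfolding ip_orthonormal_sums[OF e x] by (simp add: norm_mult power_mult_distrib)
  have sums: "?c sums (norm x)\<^sup>2"
    using norm_orthonormal_sums[OF e x] unfolding ip_orthonormal_sums[OF e x] .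
  have "(norm (x - (\<Sum>i<n. sc (ip x (e i)) (e i))))\<^sup>2 = (norm x)\<^sup>2 - (\<Sum>i<n. ?c i)"
    by (rule norm_residual[OF orthonormal_mono[OF e]]) auto
  also have "\<dots> = (\<Sum>i. ?c (i + n))"
    using suminf_split_initial_segment[OF sums_summable[OF sums], of n] sums_unique[OF sums] by simp
  also have "\<dots> \<le> (\<Sum>i. (norm (a (i + n)))\<^sup>2 * (s n)\<^sup>2)"
  proof (rule suminf_le)
    show "?c (i + n) \<le> (norm (a (i + n)))\<^sup>2 * (s n)\<^sup>2" for i
      unfolding c using s decseqD[OF dec, of n "i + n"]
      by (intro mult_left_mono power_mono) (auto intro: less_imp_le)
    show "summable (\<lambda>i. ?c (i + n))"
      using sums_summable[OF sums] by (rule summable_ignore_initial_segment)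
    show "summable (\<lambda>i. (norm (a (i + n)))\<^sup>2 * (s n)\<^sup>2)"
      by (intro summable_mult2 summable_ignore_initial_segment[OF a(1)])
  qed
  also have "\<dots> = (\<Sum>i. (norm (a (i + n)))\<^sup>2) * (s n)\<^sup>2"
    by (rule suminf_mult2[symmetric]) (rule summable_ignore_initial_segment[OF a(1)])
  also have "(\<Sum>i. (norm (a (i + n)))\<^sup>2) \<le> 1"
  proof -
    have "0 \<le> (\<Sum>i<n. (norm (a i))\<^sup>2)"
      by (simp add: sum_nonneg)
    then show ?thesis
      using suminf_split_initial_segment[OF a(1), of n] a(2) by linarith
  qed
  finally have "(norm (x - (\<Sum>i<n. sc (ip x (e i)) (e i))))\<^sup>2 \<le> (s n)\<^sup>2"
    by (simp add: mult_right_mono)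
  then show ?thesis
    by (rule power2_le_imp_le) (use s less_imp_le in blast)
qed

lemma axis_ellipsoid_norm_le:
  assumes "x \<in> axis_ellipsoid e s"
  shows "norm x \<le> s 0"
  using axis_ellipsoid_tail[OF assms, of 0] by simp

text \<open>In the span of the \<open>n + 1\<close> axes with index up to \<open>n\<close> all
  half-lengths are at least \<open>s n\<close>, so the ball of radius \<open>s n\<close> there lies
  in the ellipsoid.\<close>

lemma sum_mem_axis_ellipsoid:
  assumes "(\<Sum>i\<le>n. (norm (b i))\<^sup>2) \<le> (s n)\<^sup>2"
  shows "(\<Sum>i\<le>n. sc (b i) (e i)) \<in> axis_ellipsoid e s"
proof -
  define a where "a i = (if i \<in> {..n} then b i / of_real (s i) else 0)" for i
  have "(\<lambda>i. if i \<in> {..n} then (norm (b i / of_real (s i)))\<^sup>2 else 0) sums (\<Sum>i\<le>n. (norm (b i / of_real (s i)))\<^sup>2)"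
    by (rule sums_If_finite_set) simp
  then have a: "(\<lambda>i. (norm (a i))\<^sup>2) sums (\<Sum>i\<le>n. (norm (b i / of_real (s i)))\<^sup>2)"
    by (rule back_subst[of "\<lambda>f. f sums _"]) (auto simp: a_def)
  have "(\<Sum>i\<le>n. (norm (b i / of_real (s i)))\<^sup>2) \<le> (\<Sum>i\<le>n. (norm (b i))\<^sup>2 / (s n)\<^sup>2)"
  proof (rule sum_mono)
    fix i
    assume "i \<in> {..n}"
    then have "(s n)\<^sup>2 \<le> (s i)\<^sup>2"
      using s[of n] decseqD[OF dec, of i n] by (intro power_mono) auto
    then show "(norm (b i / of_real (s i)))\<^sup>2 \<le> (norm (b i))\<^sup>2 / (s n)\<^sup>2"
      using s[of n] s[of i] by (simp add: norm_divide power_divide divide_left_mono)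
  qed
  also have "\<dots> \<le> 1"
    using assms s[of n] by (simp add: sum_divide_distrib[symmetric])
  finally have a1: "(\<Sum>n. (norm (a n))\<^sup>2) \<le> 1"
    using sums_unique[OF a] by simp
  have "(\<lambda>i. if i \<in> {..n} then sc (b i) (e i) else 0) sums (\<Sum>i\<le>n. sc (b i) (e i))"
    by (rule sums_If_finite_set) simp
  moreover have "(if i \<in> {..n} then sc (b i) (e i) else 0) = sc (a i * of_real (s i)) (e i)" for i
    using s[of i] by (simp add: a_def)
  ultimately have "(\<lambda>i. sc (a i * of_real (s i)) (e i)) sums (\<Sum>i\<le>n. sc (b i) (e i))"
    by simp
  then show ?thesis
    unfolding axis_ellipsoid_def using sums_summable[OF a] a1 by blast
qed

lemma zero_mem_axis_ellipsoid: "0 \<in> axis_ellipsoid e s"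
  using sum_mem_axis_ellipsoid[where b = "\<lambda>_. 0" and n = 0] by simp

text \<open>Among \<open>n + 1\<close> axes some nonzero combination is orthogonal to the
  \<open>n\<close> vectors of \<open>B\<close>; rescaled to norm \<open>s n\<close> it stays in the
  ellipsoid. Its distance to the span is its norm, which gives the lower bound for the
  width.\<close>

lemma exists_orthogonal_axis_vector:
  assumes "finite B" "card B = n"
  shows "\<exists>x\<in>axis_ellipsoid e s. norm x = s n \<and> (\<forall>z\<in>span B. ip x z = 0)"
proof -
  obtain a where a: "\<exists>i\<in>{..n}. a i \<noteq> 0" and a0: "\<And>b. b \<in> B \<Longrightarrow> (\<Sum>i\<le>n. a i * ip (e i) b) = 0"
    using homogeneous_system_nontrivial_solution[OF assms(1), of "{..n}" "\<lambda>b i. ip (e i) b"] assms(2) by auto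
  define y where "y = (\<Sum>i\<le>n. sc (a i) (e i))"
  have on: "orthonormal e {..n}"
    by (rule orthonormal_mono[OF e]) simp
  have "y \<noteq> 0"
  proof
    assume "y = 0"
    then have "a i = 0" if "i \<le> n" for i
      using ip_orthonormal_sum[OF on, of i a] that unfolding y_def by simp
    then show False
      using a by auto
  qed
  define t where "t = s n / norm y"
  define x where "x = (\<Sum>i\<le>n. sc (of_real t * a i) (e i))"
  have x: "x = sc (of_real t) y"
    by (simp add: x_def y_def scale_sum_right)
  have "t > 0"
    using \<open>y \<noteq> 0\<close> s[of n] by (simp add: t_def)
  then have "norm x = t * norm y"
    by (simp add: x norm_sc)
  then have nx: "norm x = s n"
    using \<open>y \<noteq> 0\<close> by (simp add: t_def)
  have "x \<in> axis_ellipsoid e s"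
    unfolding x_def
  proof (rule sum_mem_axis_ellipsoid)
    show "(\<Sum>i\<le>n. (norm (of_real t * a i))\<^sup>2) \<le> (s n)\<^sup>2"
      using norm_orthonormal_sum[OF on finite_atMost, of "\<lambda>i. of_real t * a i"] nx
      unfolding x_def by simp
  qed
  moreover have "span B \<subseteq> {z. ip x z = 0}"
  proof (rule span_minimal)
    show "B \<subseteq> {z. ip x z = 0}"
      using a0 by (auto simp: x y_def ip_scale_left ip.sum_left)
    show "subspace {z. ip x z = 0}"
      by (rule subspaceI) (simp_all add: ip_add_right ip_scale_right)
  qed
  ultimately show ?thesis
    using nx by blast
qed

lemma INF_dist_le:
  assumes "z \<in> X"
  shows "(INF z\<in>X. norm (x - z)) \<le> norm (x - z)"
  by (rule cINF_lower[OF bdd_belowI2[where m = 0] assms]) simp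

lemma deviation_lower_bound:
  assumes "X \<in> subspaces_of_dim sc n"
  shows "s n \<le> (SUP x\<in>axis_ellipsoid e s. INF z\<in>X. norm (x - z))"
proof -
  obtain B where X: "X = span B" and B: "finite B" "card B = n"
    using assms unfolding subspaces_of_dim_def by blast
  obtain x where x: "x \<in> axis_ellipsoid e s" "norm x = s n" "\<And>z. z \<in> X \<Longrightarrow> ip x z = 0"
    using exists_orthogonal_axis_vector[OF B] X by blast
  have "0 \<in> X"
    by (simp add: X span_zero)
  have "s n \<le> (INF z\<in>X. norm (x - z))"
  proof (rule cINF_greatest)
    show "X \<noteq> {}"
      using \<open>0 \<in> X\<close> by blast
    show "s n \<le> norm (x - z)" if "z \<in> X" for z
    proof -
      have "(norm (x + - z))\<^sup>2 = (norm x)\<^sup>2 + (norm (- z))\<^sup>2"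
        by (rule pythagoras) (simp add: ip_minus_right x(3)[OF that])
      then have "(norm x)\<^sup>2 \<le> (norm (x - z))\<^sup>2"
        by simp
      then show ?thesis
        unfolding x(2)[symmetric] by (rule power2_le_imp_le) simp
    qed
  qed
  also have "\<dots> \<le> (SUP x\<in>axis_ellipsoid e s. INF z\<in>X. norm (x - z))"
  proof (rule cSUP_upper[OF x(1)])
    \<comment> \<open>Boundedness makes the real supremum dominate its members; testing with
      \<open>z = 0\<close> bounds every deviation by \<open>s 0\<close>.\<close>
    show "bdd_above ((\<lambda>x. INF z\<in>X. norm (x - z)) ` axis_ellipsoid e s)"
    proof (rule bdd_aboveI2)
      show "(INF z\<in>X. norm (x - z)) \<le> s 0" if "x \<in> axis_ellipsoid e s" for x
        using INF_dist_le[OF \<open>0 \<in> X\<close>, of x] axis_ellipsoid_norm_le[OF that] by simp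
    qed
  qed
  finally show ?thesis .
qed

text \<open>This subspace attains the width, and it shows that the infimum is over a nonempty
  family.\<close>

lemma span_initial_axes: "span (e ` {..<n}) \<in> subspaces_of_dim sc n"
proof -
  have inj: "inj e"
    by (rule injI) (metis e UNIV_I orthonormalD zero_neq_one)
  have on: "orthonormal (\<lambda>x. x) (e ` {..<n})"
    using orthonormalD[OF e] inj by (auto simp: orthonormal_def inj_eq)
  have "independent (e ` {..<n})"
  proof
    assume "dependent (e ` {..<n})"
    then obtain u where u: "\<exists>v\<in>e ` {..<n}. u v \<noteq> 0" "(\<Sum>v\<in>e ` {..<n}. sc (u v) v) = 0"
      using dependent_finite[of "e ` {..<n}"] by auto
    have "u v = 0" if "v \<in> e ` {..<n}" for v
      using ip_orthonormal_sum[OF on _ that, of u] u(2) by simp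
    then show False
      using u(1) by blast
  qed
  moreover have "card (e ` {..<n}) = n"
    using inj by (simp add: card_image inj_on_subset)
  ultimately show ?thesis
    unfolding subspaces_of_dim_def by blast
qed

lemma deviation_initial_axes:
  "(SUP x\<in>axis_ellipsoid e s. INF z\<in>span (e ` {..<n}). norm (x - z)) \<le> s n"
proof (rule cSUP_least)
  show "axis_ellipsoid e s \<noteq> {}"
    using zero_mem_axis_ellipsoid by blast
  fix x
  assume x: "x \<in> axis_ellipsoid e s"
  have "(\<Sum>i<n. sc (ip x (e i)) (e i)) \<in> span (e ` {..<n})"
    by (intro span_sum span_scale span_base) auto
  from order_trans[OF INF_dist_le[OF this] axis_ellipsoid_tail[OF x]]
  show "(INF z\<in>span (e ` {..<n}). norm (x - z)) \<le> s n" .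
qed

lemma kolmogorov_width_axis_ellipsoid: "kolmogorov_width sc (axis_ellipsoid e s) n = s n"
  unfolding kolmogorov_width_def
proof (rule antisym)
  have bdd: "bdd_below ((\<lambda>X. SUP x\<in>axis_ellipsoid e s. INF z\<in>X. norm (x - z)) ` subspaces_of_dim sc n)"
    by (rule bdd_belowI2) (rule deviation_lower_bound)
  show "(INF X\<in>subspaces_of_dim sc n. SUP x\<in>axis_ellipsoid e s. INF z\<in>X. norm (x - z)) \<le> s n"
    by (rule order_trans[OF cINF_lower[OF bdd span_initial_axes] deviation_initial_axes])
  show "s n \<le> (INF X\<in>subspaces_of_dim sc n. SUP x\<in>axis_ellipsoid e s. INF z\<in>X. norm (x - z))"
    by (rule cINF_greatest) (use span_initial_axes deviation_lower_bound in auto)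
qed

section \<open>Members of \<open>G_set\<close> and their ultraweak closure\<close>

lemma scaled_shift_bounded_operator:
  "(\<lambda>x. sc c (partial_isometry (\<lambda>n. e (n + M)) e x)) \<in> bounded_operators sc"
  by (intro bounded_operators_scale partial_isometry_bounded_operator[OF orthonormal_shift[OF e] e])

text \<open>
  The part of \<open>axis_ellipsoid e s\<close> spanned by the axes from \<open>M\<close> on already covers the whole
  ellipsoid under the scaled shift, so the values of the operator on the other directions are free.
\<close>

lemma shift_plus_vanishing_mem_G_set:
  assumes c: "c > 0" "\<And>n. c * s n \<le> s (Suc n)" and F: "F \<in> vanishing_from e M"
  shows "(\<lambda>x. sc (of_real (1 / c ^ M)) (partial_isometry (\<lambda>n. e (n + M)) e x) + F x) \<in> G_set sc (axis_ellipsoid e s)"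
    (is "?D \<in> _")
proof -
  have FB: "F \<in> bounded_operators sc" and F0: "\<And>n. F (e (n + M)) = 0"
    using F by (simp_all add: vanishing_from_def)
  have cs: "c ^ m * s n \<le> s (n + m)" for m n
  proof (induction m)
    case (Suc m)
    have "c ^ Suc m * s n \<le> c * s (n + m)"
      using mult_left_mono[OF Suc.IH, of c] c(1) by (simp add: mult.assoc)
    then show ?case
      using c(2)[of "n + m"] by simp
  qed simp
  have "y \<in> ?D ` axis_ellipsoid e s" if y_mem: "y \<in> axis_ellipsoid e s" for y
  proof -
    obtain a where a: "summable (\<lambda>n. (norm (a n))\<^sup>2)" "(\<Sum>n. (norm (a n))\<^sup>2) \<le> 1"
      and y: "(\<lambda>n. sc (a n * of_real (s n)) (e n)) sums y"
      using y_mem unfolding axis_ellipsoid_def by blast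
    \<comment> \<open>The preimage of \<open>y\<close> has coordinate \<open>b n\<close> on axis
      \<open>n + M\<close>, which the shift scaled by \<open>1 / c ^ M\<close> returns to coordinate
      \<open>a n * s n\<close> on axis \<open>n\<close>. Relative to the half-lengths these
      coordinates are \<open>a'\<close>, and \<open>cs\<close> keeps them no larger than
      \<open>a\<close>.\<close>
    define b where "b n = a n * of_real (c ^ M * s n)" for n
    define a' where "a' k = (if k < M then 0 else b (k - M) / of_real (s k))" for k
    have a'_le: "(norm (a' (n + M)))\<^sup>2 \<le> (norm (a n))\<^sup>2" for n
    proof -
      have "norm (a n) * (c ^ M * s n) \<le> norm (a n) * s (n + M)"
        using cs by (intro mult_left_mono) auto
      then have "norm (a' (n + M)) \<le> norm (a n)"
        using s[of "n + M"] s[of n] c(1)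
        by (simp add: a'_def b_def norm_divide norm_mult norm_power divide_le_eq)
      then show ?thesis
        by (rule power_mono) simp
    qed
    have a'_shift: "summable (\<lambda>n. (norm (a' (n + M)))\<^sup>2)"
      by (rule summable_comparison_test'[OF a(1), where N = 0]) (use a'_le in simp)
    have "(\<lambda>k. (norm (a' k))\<^sup>2) sums (\<Sum>n. (norm (a' (n + M)))\<^sup>2)"
      using sums_zero_iff_shift[of M "\<lambda>k. (norm (a' k))\<^sup>2"] summable_sums[OF a'_shift] by (simp add: a'_def)
    moreover have "(\<Sum>n. (norm (a' (n + M)))\<^sup>2) \<le> 1"
      using suminf_le[OF a'_le a'_shift a(1)] a(2) by simp
    ultimately have a': "summable (\<lambda>k. (norm (a' k))\<^sup>2)" "(\<Sum>k. (norm (a' k))\<^sup>2) \<le> 1"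
      using sums_summable sums_unique by (blast, metis)
    have b: "summable (\<lambda>n. (norm (b n))\<^sup>2)"
    proof (rule summable_comparison_test'[OF summable_mult[OF a(1), of "(c ^ M * s 0)\<^sup>2"], where N = 0])
      fix n
      have "norm (b n) \<le> (c ^ M * s 0) * norm (a n)"
        using c(1) s[of n] decseqD[OF dec, of 0 n]
        by (simp add: b_def norm_mult norm_power mult_left_mono mult_right_mono mult.commute)
      then have "(norm (b n))\<^sup>2 \<le> ((c ^ M * s 0) * norm (a n))\<^sup>2"
        by (rule power_mono) simp
      then show "norm ((norm (b n))\<^sup>2) \<le> (c ^ M * s 0)\<^sup>2 * (norm (a n))\<^sup>2"
        by (simp add: power_mult_distrib)
    qed
    have on: "orthonormal (\<lambda>n. e (n + M)) UNIV"
      by (rule orthonormal_shift[OF e])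
    obtain x where x: "(\<lambda>n. sc (b n) (e (n + M))) sums x"
      using summable_orthonormal[OF on b] summable_def by blast
    have "sc (a' (n + M) * of_real (s (n + M))) (e (n + M)) = sc (b n) (e (n + M))" for n
      using s[of "n + M"] by (simp add: a'_def)
    with x have "(\<lambda>n. sc (a' (n + M) * of_real (s (n + M))) (e (n + M))) sums x"
      by (simp only:)
    then have "(\<lambda>k. sc (a' k * of_real (s k)) (e k)) sums x"
      by (rule sums_zero_iff_shift[THEN iffD1, rotated]) (simp add: a'_def)
    then have "x \<in> axis_ellipsoid e s"
      unfolding axis_ellipsoid_def using a' by blast
    \<comment> \<open>By continuity \<open>F\<close> kills \<open>x\<close>, whose expansion uses
      only axes from \<open>M\<close> on.\<close>
    have "(\<lambda>n. F (sc (b n) (e (n + M)))) sums F x"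
      by (rule bounded_linear.sums[OF bounded_operator_bounded_linear[OF FB] x])
    then have "(\<lambda>_. 0) sums F x"
      by (simp only: bounded_operator_scale[OF FB] F0 scale_zero_right)
    then have "F x = 0"
      by (rule sums_unique2) simp
    have "(\<lambda>n. sc (of_real (1 / c ^ M)) (sc (b n) (e n))) sums
        sc (of_real (1 / c ^ M)) (partial_isometry (\<lambda>n. e (n + M)) e x)"
      using bounded_linear.sums[OF sc.bounded_linear_right partial_isometry_sums[OF on e, of x]]
      unfolding ip_orthonormal_sums[OF on x] .
    moreover have "sc (of_real (1 / c ^ M)) (sc (b n) (e n)) = sc (a n * of_real (s n)) (e n)" for n
      using c(1) by (simp add: b_def)
    ultimately have "(\<lambda>n. sc (a n * of_real (s n)) (e n)) sums
        sc (of_real (1 / c ^ M)) (partial_isometry (\<lambda>n. e (n + M)) e x)"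
      by (simp only:)
    then have "sc (of_real (1 / c ^ M)) (partial_isometry (\<lambda>n. e (n + M)) e x) = y"
      using y by (rule sums_unique2)
    with \<open>F x = 0\<close> \<open>x \<in> axis_ellipsoid e s\<close> show ?thesis
      by (intro image_eqI[of _ _ x]) simp_all
  qed
  moreover have "?D \<in> bounded_operators sc"
    by (intro bounded_operators_plus scaled_shift_bounded_operator FB)
  ultimately show ?thesis
    unfolding G_set_def by blast
qed

lemma closure_G_set_axis_ellipsoid:
  assumes c: "c > 0" "\<And>n. c * s n \<le> s (Suc n)"
  shows "ultraweak_topology sc ip closure_of G_set sc (axis_ellipsoid e s) = bounded_operators sc"
proof (intro equalityI subsetI)
  show "D \<in> bounded_operators sc"
    if "D \<in> ultraweak_topology sc ip closure_of G_set sc (axis_ellipsoid e s)" for D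
    by (rule subsetD[OF closure_of_subset_topspace that, unfolded topspace_ultraweak])
  fix D
  assume D: "D \<in> bounded_operators sc"
  have *: "\<exists>E. E \<in> G_set sc (axis_ellipsoid e s) \<and> E \<in> U" if U: "D \<in> U" "openin (ultraweak_topology sc ip) U" for U
  proof -
    obtain \<T> where \<T>: "finite \<T>" "\<forall>T\<in>\<T>. nuclear sc ip T"
      and \<T>U: "\<forall>E\<in>bounded_operators sc.
        (\<forall>T\<in>\<T>. operator_trace sc ip (E \<circ> T) = operator_trace sc ip (D \<circ> T)) \<longrightarrow> E \<in> U"
      using ultraweak_open_contains_trace_fiber[OF U(2,1)] by (elim exE conjE)
    have nT: "nuclear sc ip T" if "T \<in> \<T>" for T
      using \<T>(2) that by blast
    \<comment> \<open>\<open>M\<close> and \<open>R\<close> depend on \<open>\<T>\<close> alone, so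
      the shift by \<open>M\<close> can be fixed before the operator to be interpolated is formed
      from it.\<close>
    obtain M R where MR: "\<forall>D\<in>bounded_operators sc. R D \<in> vanishing_from e M \<and>
        (\<forall>T\<in>\<T>. operator_trace sc ip (R D \<circ> T) = operator_trace sc ip (D \<circ> T)) \<and>
        (\<forall>T. nuclear sc ip T \<longrightarrow>
          (\<lambda>N. operator_trace sc ip (R (\<lambda>x. D (cut_off e N x)) \<circ> T)) \<longlonglongrightarrow> operator_trace sc ip (R D \<circ> T))"
      using trace_interpolation[OF e \<T>] by (elim exE)
    have R: "R D \<in> vanishing_from e M" if "D \<in> bounded_operators sc" for D
      using MR that by blast
    have R_eq: "operator_trace sc ip (R D \<circ> T) = operator_trace sc ip (D \<circ> T)"
      if "D \<in> bounded_operators sc" "T \<in> \<T>" for D T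
      using MR that by blast
    define S where "S x = sc (of_real (1 / c ^ M)) (partial_isometry (\<lambda>n. e (n + M)) e x)" for x
    \<comment> \<open>Interpolating the difference of \<open>D\<close> and \<open>S\<close>
      compensates the traces of the shift: \<open>S\<close> plus \<open>R H\<close> has the traces
      of \<open>S\<close> plus \<open>H\<close>, which is \<open>D\<close>.\<close>
    define H where "H x = D x + sc (- 1) (S x)" for x
    have S: "S \<in> bounded_operators sc"
      unfolding S_def by (rule scaled_shift_bounded_operator)
    have H: "H \<in> bounded_operators sc"
      unfolding H_def by (intro bounded_operators_plus bounded_operators_scale D S)
    have RH: "R H \<in> bounded_operators sc"
      using R[OF H] by (simp add: vanishing_from_def)
    let ?E = "\<lambda>x. S x + R H x"
    have "?E \<in> G_set sc (axis_ellipsoid e s)"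
      unfolding S_def by (rule shift_plus_vanishing_mem_G_set[OF c R[OF H]])
    moreover have "operator_trace sc ip (?E \<circ> T) = operator_trace sc ip (D \<circ> T)" if T: "T \<in> \<T>" for T
    proof -
      have "operator_trace sc ip (?E \<circ> T) = operator_trace sc ip (S \<circ> T) + operator_trace sc ip (H \<circ> T)"
        unfolding operator_trace_plus[OF nT[OF T] S RH] R_eq[OF H T] ..
      also have "\<dots> = operator_trace sc ip ((\<lambda>x. S x + H x) \<circ> T)"
        by (rule operator_trace_plus[OF nT[OF T] S H, symmetric])
      also have "(\<lambda>x. S x + H x) = D"
        by (simp add: H_def)
      finally show ?thesis .
    qed
    then have "?E \<in> U"
      using \<T>U bounded_operators_plus[OF S RH] by blast
    ultimately show ?thesis
      by blast
  qed
  show "D \<in> ultraweak_topology sc ip closure_of G_set sc (axis_ellipsoid e s)"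
    unfolding in_closure_of topspace_ultraweak by (intro conjI allI impI D) (elim conjE, rule *)
qed

end

end

theorem theorem4p10:
  fixes sc :: "'k::hilbert_scalar \<Rightarrow> 'a::banach \<Rightarrow> 'a"
    and ip :: "'a \<Rightarrow> 'a \<Rightarrow> 'k"
    and sc' :: "'k \<Rightarrow> 'b::banach \<Rightarrow> 'b"
    and ip' :: "'b \<Rightarrow> 'b \<Rightarrow> 'k"
    and K :: "'a set"
  assumes "hilbert_space sc ip"
    and "hilbert_space sc' ip'"
    and "ellipsoid sc' sc K"
    and "\<not> lacunary (\<lambda>n. kolmogorov_width sc K (Suc n))"
  shows "ultraweak_topology sc ip closure_of G_set sc K = bounded_operators sc"
proof -
  obtain A where A: "compact_operator sc' sc A" "\<not> finite_dimensional sc (range A)"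
    and K: "K = A ` cball 0 1"
    using assms(3) unfolding ellipsoid_def by blast
  interpret compact_map sc' ip' sc ip A
    by (intro compact_map.intro compact_map_axioms.intro assms A)
  obtain e s where e: "cod.orthonormal e UNIV" and s: "\<forall>n. s n > 0" "decseq s"
    and Ke: "K = cod.axis_ellipsoid e s"
    using image_axis_ellipsoid unfolding K by (elim exE conjE)
  have pos: "s n > 0" for n
    using s(1) by blast
  have "\<not> lacunary (\<lambda>n. s (Suc n))"
    using assms(4) unfolding Ke cod.kolmogorov_width_axis_ellipsoid[OF e pos s(2)] .
  from not_lacunary_ratio[of "\<lambda>n. s (Suc n)", OF pos this]
  obtain c where c: "c > 0" "\<And>n. c * s (Suc n) \<le> s (Suc (Suc n))"
    by blast
  \<comment> \<open>The hypothesis concerns the widths from index 1 on; the minimum also covers the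
    ratio of the first two half-lengths.\<close>
  define d where "d = min c (s (Suc 0) / s 0)"
  have "d > 0"
    using c(1) pos by (simp add: d_def)
  moreover have "d * s n \<le> s (Suc n)" for n
  proof (cases n)
    case 0
    have "d \<le> s (Suc 0) / s 0"
      by (simp add: d_def)
    then show ?thesis
      using pos[of 0] by (simp add: 0 pos_le_divide_eq)
  next
    case (Suc m)
    have "d * s (Suc m) \<le> c * s (Suc m)"
      by (intro mult_right_mono less_imp_le[OF pos]) (simp add: d_def)
    then show ?thesis
      using c(2)[of m] Suc by simp
  qed
  ultimately show ?thesis
    unfolding Ke by (rule cod.closure_G_set_axis_ellipsoid[OF e pos s(2)])
qed

end
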